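(* Let $w$ be the permutation matrix of size $r$ attached to $\pi\in\mathfrak S_r$, let $1\le d\le r$, and let $D=\{1_{l(1)},1_{l(2)},\dots,1_{l(m)}\}$, $l(1)<l(2)<\cdots<l(m)$, be a $P_L$-decomposable set with respect to $d$. Let $1\le h\le m$ be such that $1_{l(h)}$ is the element of $D$ in the highest row among all rows containing an element of $D$, and let $$O=\bigl(\{\gamma(1_{\pi(d)})\}\cup\gamma(D)\bigr)\setminus\{\gamma(1_{l(h)})\}.$$ If the leftmost element of $D$ is not the highest element of $D$, that is, if $h>1$, then $$P_L(O\to D)=P_L\bigl(O_{\downarrow,\pi^{-1}(l(1))+1}\to D_{\downarrow,\pi^{-1}(l(1))}\bigr)\cdot P_L\bigl(O_{\uparrow,\pi^{-1}(l(1))}\to D_{\uparrow,\pi^{-1}(l(1))-1}\bigr)-\rho(1_{l(1)})\cdot P_L\bigl(O\setminus\{\gamma(1_{l(1)})\}\to D\setminus\{1_{l(1)}\}\bigr).$$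
   Context: **The matrix $wn$.** Let $r\ge 2$, $\pi\in\mathfrak S_r$, and let $w$ be the $r\times r$ permutation matrix with $w_{i,j}=1$ if $j=\pi(i)$ and $0$ otherwise. Put $Inv(\pi^{-1})=\{(a,b): a<b,\ \pi^{-1}(a)>\pi^{-1}(b)\}$. Let $V_w=\{n_{a,b}: (a,b)\in Inv(\pi^{-1})\}$ be a set of independent indeterminates (the *free variables* ); put $n_{a,a}=1$, and $n_{a,b}=0$ for all other pairs. Let $wn$ be the $r\times r$ matrix with $(i,j)$ entry $n_{\pi(i),j}$; so $n_{a,b}$ sits in row $\pi^{-1}(a)$ and column $b$. Denote by $1_j$ the $1$-entry of $wn$ in column $j$ (it is in row $\pi^{-1}(j)$). Entries are distinguished by position; the nonzero entries are the $1_j$ and the free variables. Row $1$ is the top (highest) row. **Paths.** Two nonzero entries of $wn$ are neighbors if they are in the same row or the same column with no other nonzero entry between them. A path from one nonzero entry to another is a sequence of nonzero entries, consecutive ones being neighbors, moving only by upward and leftward steps; its length is the number of entries minus $1$ (length $0$ is allowed). Paths are disjoint if they share no entry. For sets $A,B$ of nonzero entries with $|A|=|B|=m\ge1$, $\mathcal P(A\to B)$ is the collection of all sets of $m$ pairwise disjoint paths connecting the elements of $A$ bijectively to the elements of $B$. For a set $\mathbf p$ of disjoint paths, $u(\mathbf p)$ is the product of all free variables traversed by its paths. $\mathcal P_L(A\to B)\subseteq\mathcal P(A\to B)$ consists of the sets in which every path of length at least $1$ whose origin is in the rightmost ($r$-th) column of $wn$ starts by going left, and $P_L(A\to B)=\sum_{\mathbf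 p\in\mathcal P_L(A\to B)}u(\mathbf p)$. $\gamma(1_j)$ is the rightmost nonzero entry of the row containing $1_j$, $\gamma(I)=\{\gamma(1_j):1_j\in I\}$ for a set $I$ of $1$-entries, and $\rho(1_j)$ is the product of the nonzero entries in the row containing $1_j$. **$P_L$-decomposable sets.** A nonempty set $D$ of $1$-entries of $wn$ is $P_L$-decomposable with respect to $d$ if every $1_l\in D$ satisfies $\pi^{-1}(l)<d$ and $\pi(d)<l$, i.e. every element of $D$ is above and to the right of $1_{\pi(d)}$. **Subsets.** For a set $X$ of entries ($X=O$ or $D$), $X_{\downarrow,k}$ (resp. $X_{\uparrow,k}$) is the subset of elements in or below (resp. in or above) the $k$-th row of $wn$. *)

theory Defs
  imports "HOL-Combinatorics.Permutations" "HOL-Library.Poly_Mapping"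
begin

text \<open>
  Polynomials over \<open>'a\<close> in indeterminates indexed by pairs of naturals, as the monoid algebra
  of the finitely supported exponent vectors; \<open>var a b\<close> is the indeterminate $n_{a,b}$.
\<close>

type_synonym 'a mpoly = "((nat \<times> nat) \<Rightarrow>\<^sub>0 nat) \<Rightarrow>\<^sub>0 'a"

definition var :: "nat \<Rightarrow> nat \<Rightarrow> 'a::comm_ring_1 mpoly" where
  "var a b = Poly_Mapping.single (Poly_Mapping.single (a, b) 1) 1"

text \<open>
  Rows and columns are numbered from 1 to \<open>r\<close>, and \<open>\<pi>\<close> is meant to satisfy
  \<open>\<pi> permutes {1..r}\<close>. An entry of a matrix is represented by its position (row, column).
\<close>

definition Inv :: "nat \<Rightarrow> (nat \<Rightarrow> nat) \<Rightarrow> (nat \<times> nat) set" where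
  "Inv r \<sigma> = {(a, b). a \<in> {1..r} \<and> b \<in> {1..r} \<and> a < b \<and> \<sigma> a > \<sigma> b}"

definition nmat :: "nat \<Rightarrow> (nat \<Rightarrow> nat) \<Rightarrow> nat \<Rightarrow> nat \<Rightarrow> 'a::comm_ring_1 mpoly" where
  "nmat r \<pi> a b =
     (if a = b then 1 else if (a, b) \<in> Inv r (inv \<pi>) then var a b else 0)"

definition wn :: "nat \<Rightarrow> (nat \<Rightarrow> nat) \<Rightarrow> nat \<Rightarrow> nat \<Rightarrow> 'a::comm_ring_1 mpoly" where
  "wn r \<pi> i j = nmat r \<pi> (\<pi> i) j"

definition one_entry :: "(nat \<Rightarrow> nat) \<Rightarrow> nat \<Rightarrow> nat \<times> nat" where
  "one_entry \<pi> j = (inv \<pi> j, j)"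

definition one_entries :: "nat \<Rightarrow> (nat \<Rightarrow> nat) \<Rightarrow> (nat \<times> nat) set" where
  "one_entries r \<pi> = one_entry \<pi> ` {1..r}"

definition free_entries :: "nat \<Rightarrow> (nat \<Rightarrow> nat) \<Rightarrow> (nat \<times> nat) set" where
  "free_entries r \<pi> = {(i, j). i \<in> {1..r} \<and> j \<in> {1..r} \<and> (\<pi> i, j) \<in> Inv r (inv \<pi>)}"

definition nz :: "nat \<Rightarrow> (nat \<Rightarrow> nat) \<Rightarrow> (nat \<times> nat) set" where
  "nz r \<pi> = one_entries r \<pi> \<union> free_entries r \<pi>"

text \<open>The positions in \<open>nz\<close> are those of the nonzero entries, whatever the coefficient ring.\<close>

lemma wn_nonzero_iff:
  assumes "\<pi> permutes {1..r}" "i \<in> {1..r}" "j \<in> {1..r}"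
  shows "(wn r \<pi> i j :: 'a::comm_ring_1 mpoly) \<noteq> 0 \<longleftrightarrow> (i, j) \<in> nz r \<pi>"
proof -
  have "(var a b :: 'a mpoly) \<noteq> 0" for a b
    by (metis var_def lookup_single_eq lookup_zero zero_neq_one)
  moreover have "(i, j) \<in> one_entries r \<pi> \<longleftrightarrow> \<pi> i = j"
    using assms permutes_inverses[OF assms(1)] by (auto simp: one_entries_def one_entry_def image_iff)
  ultimately show ?thesis
    using assms by (auto simp: wn_def nmat_def nz_def free_entries_def)
qed

definition neighbors :: "nat \<Rightarrow> (nat \<Rightarrow> nat) \<Rightarrow> nat \<times> nat \<Rightarrow> nat \<times> nat \<Rightarrow> bool" where
  "neighbors r \<pi> e f \<longleftrightarrow> e \<in> nz r \<pi> \<and> f \<in> nz r \<pi> \<and> e \<noteq> f \<and>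
     (fst e = fst f \<and>
        \<not> (\<exists>g\<in>nz r \<pi>. fst g = fst e \<and>
              min (snd e) (snd f) < snd g \<and> snd g < max (snd e) (snd f)) \<or>
      snd e = snd f \<and>
        \<not> (\<exists>g\<in>nz r \<pi>. snd g = snd e \<and>
              min (fst e) (fst f) < fst g \<and> fst g < max (fst e) (fst f)))"

definition left_step :: "nat \<Rightarrow> (nat \<Rightarrow> nat) \<Rightarrow> nat \<times> nat \<Rightarrow> nat \<times> nat \<Rightarrow> bool" where
  "left_step r \<pi> e f \<longleftrightarrow> neighbors r \<pi> e f \<and> fst f = fst e \<and> snd f < snd e"

definition up_step :: "nat \<Rightarrow> (nat \<Rightarrow> nat) \<Rightarrow> nat \<times> nat \<Rightarrow> nat \<times> nat \<Rightarrow> bool" where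
  "up_step r \<pi> e f \<longleftrightarrow> neighbors r \<pi> e f \<and> snd f = snd e \<and> fst f < fst e"

text \<open>A path is the list of its entries, from \<open>hd p\<close> to \<open>last p\<close>; its length is
  \<open>length p - 1\<close>.\<close>

definition is_path :: "nat \<Rightarrow> (nat \<Rightarrow> nat) \<Rightarrow> (nat \<times> nat) list \<Rightarrow> bool" where
  "is_path r \<pi> p \<longleftrightarrow> p \<noteq> [] \<and> set p \<subseteq> nz r \<pi> \<and>
     successively (\<lambda>e f. left_step r \<pi> e f \<or> up_step r \<pi> e f) p"

text \<open>
  The bijections on origins and endpoints force \<open>card P = card A\<close> and \<open>card P = card B\<close> for
  finite \<open>A\<close>, \<open>B\<close>, so there is no such \<open>P\<close> if the cardinalities differ. The degenerate case
  \<open>A = B = {}\<close> is not excluded; it contributes the empty set of paths.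
\<close>

definition disjoint_paths ::
  "nat \<Rightarrow> (nat \<Rightarrow> nat) \<Rightarrow> (nat \<times> nat) set \<Rightarrow> (nat \<times> nat) set \<Rightarrow> (nat \<times> nat) list set set" where
  "disjoint_paths r \<pi> A B = {P. (\<forall>p\<in>P. is_path r \<pi> p) \<and>
     pairwise (\<lambda>p q. disjnt (set p) (set q)) P \<and> bij_betw hd P A \<and> bij_betw last P B}"

definition disjoint_paths_L ::
  "nat \<Rightarrow> (nat \<Rightarrow> nat) \<Rightarrow> (nat \<times> nat) set \<Rightarrow> (nat \<times> nat) set \<Rightarrow> (nat \<times> nat) list set set" where
  "disjoint_paths_L r \<pi> A B = {P \<in> disjoint_paths r \<pi> A B.
     \<forall>p\<in>P. length p - 1 \<ge> 1 \<and> snd (hd p) = r \<longrightarrow> left_step r \<pi> (p ! 0) (p ! 1)}"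

definition u :: "nat \<Rightarrow> (nat \<Rightarrow> nat) \<Rightarrow> (nat \<times> nat) list set \<Rightarrow> 'a::comm_ring_1 mpoly" where
  "u r \<pi> P = (\<Prod>(i, j) \<in> (\<Union>p\<in>P. set p) \<inter> free_entries r \<pi>. wn r \<pi> i j)"

definition PL ::
  "nat \<Rightarrow> (nat \<Rightarrow> nat) \<Rightarrow> (nat \<times> nat) set \<Rightarrow> (nat \<times> nat) set \<Rightarrow> 'a::comm_ring_1 mpoly" where
  "PL r \<pi> A B = (\<Sum>P\<in>disjoint_paths_L r \<pi> A B. u r \<pi> P)"

text \<open>The sum defining \<open>PL\<close> has finitely many terms, so it is never the default value 0 of a sum
  over an infinite set.\<close>

lemma finite_nz: "finite (nz r \<pi>)"
proof -
  have "free_entries r \<pi> \<subseteq> {1..r} \<times> {1..r}"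
    by (auto simp: free_entries_def)
  then show ?thesis
    by (auto simp: nz_def one_entries_def intro: finite_subset)
qed

lemma is_path_distinct:
  assumes "is_path r \<pi> p"
  shows "distinct p"
proof -
  have "successively (\<lambda>e f. fst f + snd f < fst e + snd e) p"
    using assms unfolding is_path_def
    by (auto elim!: successively_mono simp: left_step_def up_step_def)
  then have "sorted_wrt (\<lambda>e f. fst f + snd f < fst e + snd e) p"
    by (subst (asm) successively_conv_sorted_wrt) (auto simp: transp_def)
  then show ?thesis
    by (induction p) auto
qed

lemma finite_disjoint_paths_L: "finite (disjoint_paths_L r \<pi> A B)"
proof -
  have "set p \<subseteq> nz r \<pi> \<and> length p \<le> card (nz r \<pi>)" if "is_path r \<pi> p" for p
  proof -
    have sub: "set p \<subseteq> nz r \<pi>"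
      using that by (simp add: is_path_def)
    then show ?thesis
      using card_mono[OF finite_nz sub] distinct_card[OF is_path_distinct[OF that]] by simp
  qed
  then have "{p. is_path r \<pi> p} \<subseteq> {p. set p \<subseteq> nz r \<pi> \<and> length p \<le> card (nz r \<pi>)}"
    by blast
  then have "finite {p. is_path r \<pi> p}"
    using finite_lists_length_le[OF finite_nz] by (rule finite_subset)
  moreover have "disjoint_paths_L r \<pi> A B \<subseteq> Pow {p. is_path r \<pi> p}"
    by (auto simp: disjoint_paths_L_def disjoint_paths_def)
  ultimately show ?thesis
    by (meson finite_Pow_iff finite_subset)
qed

definition gam :: "nat \<Rightarrow> (nat \<Rightarrow> nat) \<Rightarrow> nat \<times> nat \<Rightarrow> nat \<times> nat" where
  "gam r \<pi> e = (fst e, Max {j. (fst e, j) \<in> nz r \<pi>})"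

definition rho :: "nat \<Rightarrow> (nat \<Rightarrow> nat) \<Rightarrow> nat \<times> nat \<Rightarrow> 'a::comm_ring_1 mpoly" where
  "rho r \<pi> e = (\<Prod>j \<in> {j. (fst e, j) \<in> nz r \<pi>}. wn r \<pi> (fst e) j)"

definition PL_decomposable :: "nat \<Rightarrow> (nat \<Rightarrow> nat) \<Rightarrow> nat \<Rightarrow> (nat \<times> nat) set \<Rightarrow> bool" where
  "PL_decomposable r \<pi> d D \<longleftrightarrow> D \<noteq> {} \<and> D \<subseteq> one_entries r \<pi> \<and>
     (\<forall>l. one_entry \<pi> l \<in> D \<longrightarrow> inv \<pi> l < d \<and> \<pi> d < l)"

definition weakly_below :: "nat \<Rightarrow> (nat \<times> nat) set \<Rightarrow> (nat \<times> nat) set" where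
  "weakly_below k X = {e \<in> X. fst e \<ge> k}"

definition weakly_above :: "nat \<Rightarrow> (nat \<times> nat) set \<Rightarrow> (nat \<times> nat) set" where
  "weakly_above k X = {e \<in> X. fst e \<le> k}"

end

theory Submission
  imports Defs
begin

text \<open>
  Let \<open>k\<close> be the row of \<open>1\<^bsub>l(1)\<^esub>\<close>. Expand the product on the right-hand side as a sum over pairs of
  families \<open>(P\<^sub>1, P\<^sub>2)\<close>, where \<open>P\<^sub>1\<close> lives in rows \<open>\<ge> k\<close> and \<open>P\<^sub>2\<close> in rows \<open>\<le> k\<close>. In row \<open>k\<close>, \<open>P\<^sub>1\<close> has
  only the end of the path \<open>a\<close> arriving at \<open>1\<^bsub>l(1)\<^esub>\<close>, and \<open>P\<^sub>2\<close> only the beginning of the path \<open>b\<close>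
  departing from the rightmost entry of the row. The pairs without common entry correspond, by
  union, to the families from \<open>O\<close> to \<open>D\<close>. If \<open>a\<close> enters row \<open>k\<close> in column \<open>j\<close> and \<open>b\<close> leaves it in
  column \<open>j'\<close>, then the remaining pairs are those with \<open>j' \<le> j\<close>. In that case \<open>a\<close> and \<open>b\<close> cover the
  whole row, and the columns from \<open>j'\<close> to \<open>j\<close> twice; following \<open>a\<close> up to row \<open>k\<close>, then the row from
  \<open>j\<close> to \<open>j'\<close>, then \<open>b\<close>, gives a bijection onto the families avoiding the origin and the endpoint in
  row \<open>k\<close>, and the weight changes by the product of the row.
\<close>

section \<open>Families of disjoint paths and their weights\<close>

text \<open>The condition on first steps concerns each path separately. Bundling it with
  \<open>is_path\<close> lets paths be cut and glued one at a time.\<close>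

definition L_path :: "nat \<Rightarrow> (nat \<Rightarrow> nat) \<Rightarrow> (nat \<times> nat) list \<Rightarrow> bool" where
  "L_path r \<pi> p \<longleftrightarrow> is_path r \<pi> p \<and>
     (length p - 1 \<ge> 1 \<and> snd (hd p) = r \<longrightarrow> left_step r \<pi> (p ! 0) (p ! 1))"

lemma L_path_is_path: "L_path r \<pi> p \<Longrightarrow> is_path r \<pi> p"
  by (simp add: L_path_def)

lemma is_path_nonempty: "is_path r \<pi> p \<Longrightarrow> p \<noteq> []"
  by (simp add: is_path_def)

lemma disjoint_paths_L_iff:
  "P \<in> disjoint_paths_L r \<pi> A B \<longleftrightarrow> (\<forall>p\<in>P. L_path r \<pi> p) \<and>
     pairwise (\<lambda>p q. disjnt (set p) (set q)) P \<and> bij_betw hd P A \<and> bij_betw last P B"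
  by (auto simp: disjoint_paths_L_def disjoint_paths_def L_path_def)

definition verts :: "'b list set \<Rightarrow> 'b set" where
  "verts P = (\<Union>p\<in>P. set p)"

lemma verts_simps [simp]:
  "verts (insert p P) = set p \<union> verts P" "verts (P \<union> Q) = verts P \<union> verts Q"
  by (auto simp: verts_def)

text \<open>Defined on sets of entries rather than on families, so that overlapping families can be
  compared through unions and intersections.\<close>

definition weight :: "nat \<Rightarrow> (nat \<Rightarrow> nat) \<Rightarrow> (nat \<times> nat) set \<Rightarrow> 'a::comm_ring_1 mpoly" where
  "weight r \<pi> V = (\<Prod>(i, j) \<in> V \<inter> free_entries r \<pi>. wn r \<pi> i j)"

lemma u_weight: "u r \<pi> P = weight r \<pi> (verts P)"
  by (simp add: u_def weight_def verts_def)

lemma finite_free_entries: "finite (free_entries r \<pi>)"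
  using finite_nz[of r \<pi>] by (simp add: nz_def)

lemma weight_Un_Int:
  "weight r \<pi> (V \<union> W) * weight r \<pi> (V \<inter> W) = weight r \<pi> V * (weight r \<pi> W :: 'a::comm_ring_1 mpoly)"
proof -
  let ?F = "free_entries r \<pi>"
  have "(V \<union> W) \<inter> ?F = (V \<inter> ?F) \<union> (W \<inter> ?F)" "(V \<inter> W) \<inter> ?F = (V \<inter> ?F) \<inter> (W \<inter> ?F)" by auto
  then show ?thesis
    unfolding weight_def by (simp only:) (rule prod.union_inter; simp add: finite_free_entries)
qed

lemma weight_Un_disjoint:
  "V \<inter> W = {} \<Longrightarrow> weight r \<pi> (V \<union> W) = weight r \<pi> V * (weight r \<pi> W :: 'a::comm_ring_1 mpoly)"
  using weight_Un_Int[of r \<pi> V W, where 'a='a] by (simp add: weight_def)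

text \<open>The condition on first steps involves only the first two entries, and these lie in the
  common prefix ending with \<open>y\<close> because \<open>xs\<close> is nonempty.\<close>

lemma L_path_cong_prefix:
  assumes "xs \<noteq> []" "L_path r \<pi> (xs @ y # t)" "is_path r \<pi> (xs @ y # t')"
  shows "L_path r \<pi> (xs @ y # t')"
proof -
  have "(xs @ y # t) ! 0 = (xs @ y # t') ! 0" "(xs @ y # t) ! 1 = (xs @ y # t') ! 1"
    using assms(1) by (auto simp: nth_append nth_Cons' neq_Nil_conv)
  moreover have "length xs \<ge> 1" using assms(1) by (cases xs) auto
  ultimately show ?thesis using assms by (auto simp: L_path_def)
qed

lemma ends_subset_verts:
  assumes "P \<in> disjoint_paths_L r \<pi> A B"
  shows "A \<subseteq> verts P" "B \<subseteq> verts P"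
proof -
  have "hd q \<in> verts P" "last q \<in> verts P" if "q \<in> P" for q
    using assms that by (force simp: disjoint_paths_L_iff L_path_def is_path_def verts_def)+
  then show "A \<subseteq> verts P" "B \<subseteq> verts P"
    using assms by (auto simp: disjoint_paths_L_iff bij_betw_def)
qed

lemma disjoint_paths_L_Un:
  assumes P: "P \<in> disjoint_paths_L r \<pi> A B" and Q: "Q \<in> disjoint_paths_L r \<pi> A' B'"
    and disj: "verts P \<inter> verts Q = {}"
  shows "P \<union> Q \<in> disjoint_paths_L r \<pi> (A \<union> A') (B \<union> B')"
proof -
  have "A \<inter> A' = {}" "B \<inter> B' = {}"
    using ends_subset_verts[OF P] ends_subset_verts[OF Q] disj by blast+
  then have "bij_betw hd (P \<union> Q) (A \<union> A')" "bij_betw last (P \<union> Q) (B \<union> B')"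
    using P Q unfolding disjoint_paths_L_iff by (auto intro: bij_betw_combine)
  moreover have "disjnt (set p) (set q)" if "p \<in> P" "q \<in> Q" for p q
    using disj that by (auto simp: verts_def disjnt_def)
  then have "pairwise (\<lambda>p q. disjnt (set p) (set q)) (P \<union> Q)"
    using P Q unfolding disjoint_paths_L_iff pairwise_def by (metis Un_iff disjnt_sym)
  ultimately show ?thesis using P Q unfolding disjoint_paths_L_iff by auto
qed

lemma disjoint_paths_L_insert:
  assumes "P \<in> disjoint_paths_L r \<pi> A B" "L_path r \<pi> p" "set p \<inter> verts P = {}"
  shows "insert p P \<in> disjoint_paths_L r \<pi> (insert (hd p) A) (insert (last p) B)"
proof -
  have "{p} \<in> disjoint_paths_L r \<pi> {hd p} {last p}"
    using assms(2) by (simp add: disjoint_paths_L_iff)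
  from disjoint_paths_L_Un[OF this assms(1)] show ?thesis
    using assms(3) by (simp add: verts_def)
qed

lemma disjoint_paths_L_subset:
  assumes "P \<in> disjoint_paths_L r \<pi> A B" "S \<subseteq> P"
  shows "S \<in> disjoint_paths_L r \<pi> (hd ` S) (last ` S)"
proof -
  have "pairwise (\<lambda>p q. disjnt (set p) (set q)) S" "inj_on hd S" "inj_on last S"
    using assms by (auto simp: disjoint_paths_L_iff bij_betw_def intro: inj_on_subset pairwise_subset)
  then show ?thesis
    using assms by (auto simp: disjoint_paths_L_iff bij_betw_def)
qed

lemma disjoint_paths_L_disjnt:
  assumes "P \<in> disjoint_paths_L r \<pi> A B" "S \<subseteq> P" "T \<subseteq> P" "S \<inter> T = {}"
  shows "verts S \<inter> verts T = {}"
proof -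
  have "set p \<inter> set q = {}" if "p \<in> S" "q \<in> T" for p q
  proof -
    have "p \<in> P" "q \<in> P" "p \<noteq> q" using assms(2-4) that by auto
    then show ?thesis
      using assms(1) by (auto simp: disjoint_paths_L_iff pairwise_def disjnt_def)
  qed
  then show ?thesis by (auto simp: verts_def)
qed

section \<open>Monotone lists and sorted sets\<close>

lemma filter_rows_append:
  fixes p :: "(nat \<times> nat) list"
  assumes "sorted_wrt (\<lambda>e f. fst f \<le> fst e) p"
  shows "p = filter (\<lambda>e. k < fst e) p @ filter (\<lambda>e. fst e = k) p @ filter (\<lambda>e. fst e < k) p"
  using assms
proof (induction p)
  case (Cons e p)
  have le: "\<forall>f\<in>set p. fst f \<le> fst e" and s: "sorted_wrt (\<lambda>e f. fst f \<le> fst e) p"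
    using Cons.prems by auto
  consider "k < fst e" | "fst e = k" | "fst e < k" by linarith
  then show ?case
  proof cases
    case 1 then show ?thesis using Cons.IH[OF s] by simp
  next
    case 2
    then have "filter (\<lambda>e. k < fst e) p = []" using le by (auto simp: filter_empty_conv)
    then show ?thesis using 2 Cons.IH[OF s] by simp
  next
    case 3
    then have "filter (\<lambda>e. k < fst e) p = []" "filter (\<lambda>e. fst e = k) p = []"
      using le by (fastforce simp: filter_empty_conv)+
    then show ?thesis using 3 Cons.IH[OF s] by simp
  qed
qed simp

text \<open>The absence of elements of \<open>S\<close> between two consecutive ones is what makes
  the entries listed by \<open>row_seg\<close> neighbors.\<close>

lemma successively_sorted_list_of_set:
  fixes S :: "'b::linorder set"
  assumes "finite S"
  shows "successively (\<lambda>x y. x < y \<and> \<not> (\<exists>z\<in>S. x < z \<and> z < y)) (sorted_list_of_set S)"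
  unfolding successively_conv_nth
proof (intro allI impI conjI)
  fix i let ?L = "sorted_list_of_set S"
  assume i: "Suc i < length ?L"
  have s: "sorted_wrt (<) ?L" by (rule strict_sorted_list_of_set)
  then show "?L ! i < ?L ! Suc i" using i by (auto simp: sorted_wrt_iff_nth_less)
  show "\<not> (\<exists>z\<in>S. ?L ! i < z \<and> z < ?L ! Suc i)"
  proof
    assume "\<exists>z\<in>S. ?L ! i < z \<and> z < ?L ! Suc i"
    then obtain m where m: "m < length ?L" "?L ! i < ?L ! m" "?L ! m < ?L ! Suc i"
      using assms by (metis in_set_conv_nth set_sorted_list_of_set)
    have "m \<le> i \<or> Suc i \<le> m" by auto
    then show False
      using m i s by (metis Suc_lessD leD le_neq_implies_less order_less_asym sorted_wrt_nth_less)
  qed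
qed

lemma sorted_list_of_set_snoc:
  fixes S :: "'b::linorder set"
  assumes "finite S" "\<And>x. x \<in> S \<Longrightarrow> x < y"
  shows "sorted_list_of_set (insert y S) = sorted_list_of_set S @ [y]"
proof -
  have "y \<notin> S" using assms(2) by blast
  moreover have "\<forall>x\<in>set (sorted_list_of_set S). x \<le> y" using assms by (auto intro: less_imp_le)
  ultimately show ?thesis using assms(1) by (simp add: sorted_insort_is_snoc)
qed

section \<open>Nonzero entries and paths along a row\<close>

locale perm_entries =
  fixes r :: nat and \<pi> :: "nat \<Rightarrow> nat"
  assumes perm: "\<pi> permutes {1..r}"
begin

lemma inv_\<pi> [simp]: "inv \<pi> (\<pi> i) = i" "\<pi> (inv \<pi> i) = i"
  using permutes_inverses[OF perm] by auto

lemma \<pi>_in: "\<pi> i \<in> {1..r} \<longleftrightarrow> i \<in> {1..r}" "inv \<pi> i \<in> {1..r} \<longleftrightarrow> i \<in> {1..r}"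
  using permutes_in_image[OF perm] permutes_in_image[OF permutes_inv[OF perm]] by auto

text \<open>Weak inequalities treat the 1-entries and the free entries together: equality in one of
  the last two conditions forces equality in the other. Geometrically, the entry is weakly right of
  the 1 in its row and weakly below the 1 in its column.\<close>

lemma nz_iff: "(i, j) \<in> nz r \<pi> \<longleftrightarrow> i \<in> {1..r} \<and> j \<in> {1..r} \<and> \<pi> i \<le> j \<and> inv \<pi> j \<le> i"
proof -
  have "(i, j) \<in> one_entries r \<pi> \<longleftrightarrow> j \<in> {1..r} \<and> i = inv \<pi> j"
    by (auto simp: one_entries_def one_entry_def)
  moreover have "(i, j) \<in> free_entries r \<pi> \<longleftrightarrow> i \<in> {1..r} \<and> j \<in> {1..r} \<and> \<pi> i < j \<and> inv \<pi> j < i"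
    using \<pi>_in(1)[of i] by (auto simp: free_entries_def Inv_def)
  ultimately show ?thesis using \<pi>_in(2)[of j] unfolding nz_def
    by (metis UnE UnI1 UnI2 inv_\<pi> le_neq_implies_less less_imp_le order_refl)
qed

abbreviation step :: "nat \<times> nat \<Rightarrow> nat \<times> nat \<Rightarrow> bool" where
  "step e f \<equiv> left_step r \<pi> e f \<or> up_step r \<pi> e f"

lemma is_path_append:
  "p \<noteq> [] \<Longrightarrow> q \<noteq> [] \<Longrightarrow>
   is_path r \<pi> (p @ q) \<longleftrightarrow> is_path r \<pi> p \<and> is_path r \<pi> q \<and> step (last p) (hd q)"
  by (auto simp: is_path_def successively_append_iff)

lemma path_sorted:
  assumes "is_path r \<pi> p"
  shows "sorted_wrt (\<lambda>e f. fst f \<le> fst e \<and> snd f \<le> snd e) p"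
proof -
  have "successively (\<lambda>e f. fst f \<le> fst e \<and> snd f \<le> snd e) p"
    using assms unfolding is_path_def
    by (auto elim!: successively_mono simp: left_step_def up_step_def)
  then show ?thesis
    by (subst (asm) successively_conv_sorted_wrt) (auto simp: transp_def)
qed

lemma path_bounds:
  assumes "is_path r \<pi> p" "e \<in> set p"
  shows "fst (last p) \<le> fst e" "fst e \<le> fst (hd p)" "snd (last p) \<le> snd e" "snd e \<le> snd (hd p)"
proof -
  have ne: "p \<noteq> []" using assms by auto
  have "sorted_wrt (\<lambda>e f. fst f \<le> fst e \<and> snd f \<le> snd e) (hd p # tl p)"
    using path_sorted[OF assms(1)] ne by simp
  then show "fst e \<le> fst (hd p)" "snd e \<le> snd (hd p)"
    using assms(2) ne by (cases p; fastforce)+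
  have "sorted_wrt (\<lambda>e f. fst f \<le> fst e \<and> snd f \<le> snd e) (butlast p @ [last p])"
    using path_sorted[OF assms(1)] ne by simp
  moreover have "e \<in> set (butlast p @ [last p])" using assms(2) ne by simp
  ultimately show "fst (last p) \<le> fst e" "snd (last p) \<le> snd e"
    by (auto simp: sorted_wrt_append)
qed

lemma path_rows:
  assumes "is_path r \<pi> p"
  shows "p = filter (\<lambda>e. k < fst e) p @ filter (\<lambda>e. fst e = k) p @ filter (\<lambda>e. fst e < k) p"
  by (rule filter_rows_append, rule sorted_wrt_mono_rel[OF _ path_sorted[OF assms]]) auto

definition row_cols :: "nat \<Rightarrow> nat \<Rightarrow> nat \<Rightarrow> nat set" where
  "row_cols k a b = {x. (k, x) \<in> nz r \<pi> \<and> a \<le> x \<and> x \<le> b}"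

text \<open>Reversed because paths run leftward. For \<open>a > b\<close> the list is empty.\<close>

definition row_seg :: "nat \<Rightarrow> nat \<Rightarrow> nat \<Rightarrow> (nat \<times> nat) list" where
  "row_seg k a b = map (Pair k) (rev (sorted_list_of_set (row_cols k a b)))"

lemma finite_row_cols: "finite (row_cols k a b)"
  by (rule finite_subset[of _ "snd ` nz r \<pi>"]) (force simp: row_cols_def finite_nz)+

lemma set_row_seg: "set (row_seg k a b) = Pair k ` row_cols k a b"
  by (simp add: row_seg_def finite_row_cols)

lemma row_seg_path:
  assumes "(k, a) \<in> nz r \<pi>" "(k, b) \<in> nz r \<pi>" "a \<le> b"
  shows "is_path r \<pi> (row_seg k a b)" "hd (row_seg k a b) = (k, b)" "last (row_seg k a b) = (k, a)"
    "row_seg k a b \<noteq> []"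
proof -
  let ?S = "row_cols k a b"
  have mem: "a \<in> ?S" "b \<in> ?S" using assms by (auto simp: row_cols_def)
  have ne: "sorted_list_of_set ?S \<noteq> []" using mem finite_row_cols by (metis empty_iff set_empty set_sorted_list_of_set)
  then show ne': "row_seg k a b \<noteq> []" by (simp add: row_seg_def)
  have succ: "successively (\<lambda>x y. x < y \<and> \<not> (\<exists>z\<in>?S. x < z \<and> z < y)) (sorted_list_of_set ?S)"
    by (rule successively_sorted_list_of_set[OF finite_row_cols])
  have "successively (\<lambda>y x. step (k, y) (k, x)) (rev (sorted_list_of_set ?S))"
    unfolding successively_rev
    by (rule successively_mono[OF succ])
      (auto simp: left_step_def neighbors_def finite_row_cols row_cols_def min_def max_def)
  then show "is_path r \<pi> (row_seg k a b)"
    using ne' unfolding is_path_def row_seg_def successively_map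
    by (auto simp: finite_row_cols row_cols_def)
  have min: "Min ?S = a" using mem finite_row_cols by (intro Min_eqI) (auto simp: row_cols_def)
  have "sorted_list_of_set ?S = a # sorted_list_of_set (?S - {a})"
    using sorted_list_of_set_nonempty[OF finite_row_cols, of k a b] mem unfolding min by blast
  then have "hd (sorted_list_of_set ?S) = a" by simp
  then show "last (row_seg k a b) = (k, a)" using ne by (simp add: row_seg_def last_map last_rev)
  have "sorted_list_of_set (insert b (?S - {b})) = sorted_list_of_set (?S - {b}) @ [b]"
    by (rule sorted_list_of_set_snoc) (auto simp: finite_row_cols row_cols_def)
  then have "last (sorted_list_of_set ?S) = b" using mem by (simp add: insert_absorb)
  then show "hd (row_seg k a b) = (k, b)" using ne by (simp add: row_seg_def hd_map hd_rev)
qed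

text \<open>Inside a row every step goes to the next nonzero entry on the left, so there is no
  choice. The induction removes the origin, which is the rightmost entry of the segment.\<close>

lemma row_path_unique:
  assumes "is_path r \<pi> s" "\<forall>e\<in>set s. fst e = k"
  shows "s = row_seg k (snd (last s)) (snd (hd s))"
  using assms
proof (induction s)
  case Nil then show ?case by (simp add: is_path_def)
next
  case (Cons e t)
  obtain y where e: "e = (k, y)" using Cons.prems by (cases e) auto
  have ynz: "(k, y) \<in> nz r \<pi>" using Cons.prems e by (auto simp: is_path_def)
  show ?case
  proof (cases "t = []")
    case True
    have "row_cols k y y = {y}" using ynz by (auto simp: row_cols_def)
    then show ?thesis using True e by (simp add: row_seg_def)
  next
    case False
    then have t: "is_path r \<pi> t" "step e (hd t)" using Cons.prems(1) is_path_append[of "[e]" t] by auto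
    have IH: "t = row_seg k (snd (last t)) (snd (hd t))" using Cons t by auto
    have row: "fst (hd t) = k" using Cons.prems False by auto
    have st: "left_step r \<pi> e (hd t)" using t(2) row e by (auto simp: up_step_def)
    let ?a = "snd (last t)" and ?b = "snd (hd t)"
    have lt: "?b < y" and nb: "\<And>z. (k, z) \<in> nz r \<pi> \<Longrightarrow> \<not> (?b < z \<and> z < y)"
      using st e row by (auto simp: left_step_def neighbors_def)
    have ab: "?a \<le> ?b" using path_bounds(4)[OF t(1), of "last t"] False by auto
    have "x \<le> ?b" if "(k, x) \<in> nz r \<pi>" "x \<le> y" "x \<noteq> y" for x
      using nb[OF that(1)] that by linarith
    then have "row_cols k ?a y = insert y (row_cols k ?a ?b)"
      using lt ab ynz unfolding row_cols_def by fastforce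
    moreover have "sorted_list_of_set (insert y (row_cols k ?a ?b)) = sorted_list_of_set (row_cols k ?a ?b) @ [y]"
      by (rule sorted_list_of_set_snoc) (use lt in \<open>auto simp: finite_row_cols row_cols_def\<close>)
    ultimately have "row_seg k ?a y = (k, y) # row_seg k ?a ?b" by (simp add: row_seg_def)
    then show ?thesis using IH False e by simp
  qed
qed

end

subsection \<open>Paths and a fixed row\<close>

text \<open>Row \<open>k\<close> has its \<open>1\<close>-entry in column \<open>c\<close> and its rightmost nonzero entry in column \<open>g\<close>.\<close>

locale row_cut = perm_entries +
  fixes k c g :: nat
  assumes k_in: "k \<in> {1..r}"
    and c_def: "c = \<pi> k"
    and g_def: "g = Max {j. (k, j) \<in> nz r \<pi>}"
begin

lemma row_nz: "(k, c) \<in> nz r \<pi>" "(k, g) \<in> nz r \<pi>" "(k, x) \<in> nz r \<pi> \<Longrightarrow> c \<le> x \<and> x \<le> g"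
proof -
  have fin: "finite {j. (k, j) \<in> nz r \<pi>}"
    by (rule finite_subset[of _ "snd ` nz r \<pi>"]) (force simp: finite_nz)+
  show kc: "(k, c) \<in> nz r \<pi>" using k_in \<pi>_in(1)[of k] by (simp add: nz_iff c_def)
  then show "(k, g) \<in> nz r \<pi>" using Max_in[OF fin] unfolding g_def by blast
  show "c \<le> x \<and> x \<le> g" if "(k, x) \<in> nz r \<pi>"
    using that Max_ge[OF fin, of x] by (auto simp: g_def c_def nz_iff)
qed

definition low :: "(nat \<times> nat) list \<Rightarrow> (nat \<times> nat) list" where
  "low p = filter (\<lambda>e. k < fst e) p"

definition high :: "(nat \<times> nat) list \<Rightarrow> (nat \<times> nat) list" where
  "high p = filter (\<lambda>e. fst e < k) p"

text \<open>\<open>enter\<close> and \<open>leave\<close> are meaningful only for paths meeting row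
  \<open>k\<close>. For these the two columns determine the whole part of the path in that
  row.\<close>

definition enter :: "(nat \<times> nat) list \<Rightarrow> nat" where
  "enter p = snd (hd (filter (\<lambda>e. fst e = k) p))"

definition leave :: "(nat \<times> nat) list \<Rightarrow> nat" where
  "leave p = snd (last (filter (\<lambda>e. fst e = k) p))"

lemma set_low_high: "e \<in> set (low p) \<Longrightarrow> k < fst e" "e \<in> set (high p) \<Longrightarrow> fst e < k"
  by (auto simp: low_def high_def)

text \<open>Rows weakly decrease along a path, so its entries in row \<open>k\<close> form one
  contiguous block, which \<open>row_path_unique\<close> identifies.\<close>

lemma path_through_row:
  assumes p: "is_path r \<pi> p" and e: "e \<in> set p" "fst e = k"
  shows "p = low p @ row_seg k (leave p) (enter p) @ high p"
    "(k, leave p) \<in> nz r \<pi>" "(k, enter p) \<in> nz r \<pi>" "leave p \<le> enter p"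
proof -
  let ?m = "filter (\<lambda>e. fst e = k) p"
  have split: "p = low p @ ?m @ high p"
    using path_rows[OF p, of k] by (simp add: low_def high_def)
  have "e \<in> set ?m" using e by simp
  then have ne: "?m \<noteq> []" by (metis empty_iff list.set(1))
  have "successively step (low p @ ?m @ high p)"
    using p split unfolding is_path_def by metis
  then have m: "is_path r \<pi> ?m"
    using p ne by (auto simp: is_path_def successively_append_iff)
  then have "?m = row_seg k (leave p) (enter p)"
    unfolding leave_def enter_def by (rule row_path_unique) simp
  then show "p = low p @ row_seg k (leave p) (enter p) @ high p" using split by simp
  have "hd ?m \<in> set ?m" "last ?m \<in> set ?m" using ne by (rule hd_in_set, rule last_in_set)
  moreover have "x \<in> nz r \<pi> \<and> fst x = k" if "x \<in> set ?m" for x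
    using that p by (auto simp: is_path_def)
  ultimately have "hd ?m = (k, enter p)" "last ?m = (k, leave p)" "hd ?m \<in> nz r \<pi>" "last ?m \<in> nz r \<pi>"
    unfolding enter_def leave_def prod_eq_iff fst_conv snd_conv by blast+
  then show "(k, leave p) \<in> nz r \<pi>" "(k, enter p) \<in> nz r \<pi>" "leave p \<le> enter p"
    using path_bounds(4)[OF m last_in_set[OF ne]] by simp_all
qed

lemma row_parts:
  assumes "\<forall>e\<in>set xs. k < fst e" "\<forall>e\<in>set ys. fst e < k"
    and "(k, a) \<in> nz r \<pi>" "(k, b) \<in> nz r \<pi>" "a \<le> b"
  shows "low (xs @ row_seg k a b @ ys) = xs" "high (xs @ row_seg k a b @ ys) = ys"
    "enter (xs @ row_seg k a b @ ys) = b" "leave (xs @ row_seg k a b @ ys) = a"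
proof -
  have row: "\<forall>e\<in>set (row_seg k a b). fst e = k" by (auto simp: set_row_seg)
  have "filter (\<lambda>e. k < fst e) xs = xs" "filter (\<lambda>e. fst e < k) xs = []" "filter (\<lambda>e. fst e = k) xs = []"
    "filter (\<lambda>e. k < fst e) ys = []" "filter (\<lambda>e. fst e < k) ys = ys" "filter (\<lambda>e. fst e = k) ys = []"
    "filter (\<lambda>e. k < fst e) (row_seg k a b) = []" "filter (\<lambda>e. fst e < k) (row_seg k a b) = []"
    "filter (\<lambda>e. fst e = k) (row_seg k a b) = row_seg k a b"
    using assms(1,2) row by (force simp: filter_empty_conv filter_id_conv)+
  then show "low (xs @ row_seg k a b @ ys) = xs" "high (xs @ row_seg k a b @ ys) = ys"
    "enter (xs @ row_seg k a b @ ys) = b" "leave (xs @ row_seg k a b @ ys) = a"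
    using row_seg_path[OF assms(3-5)] by (simp_all add: low_def high_def enter_def leave_def)
qed

text \<open>A step jumping over row \<open>k\<close> in column \<open>j\<close> forces \<open>j < c\<close>: for \<open>j \<ge> c\<close> a nonzero entry
  above row \<open>k\<close> makes the entry \<open>(k, j)\<close> nonzero.\<close>

lemma crossing_path_meets_row:
  assumes q: "is_path r \<pi> q" and "k < fst (hd q)" "fst (last q) < k" "c \<le> snd (last q)"
  shows "\<exists>e\<in>set q. fst e = k"
proof (rule ccontr)
  assume "\<not> ?thesis"
  then have "filter (\<lambda>e. fst e = k) q = []" by (auto simp: filter_empty_conv)
  then have split: "q = low q @ high q" using path_rows[OF q, of k] by (simp add: low_def high_def)
  have ne: "q \<noteq> []" using q by (simp add: is_path_def)
  then have "hd q \<in> set (low q)" "last q \<in> set (high q)" using assms by (auto simp: low_def high_def)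
  then have ne2: "low q \<noteq> []" "high q \<noteq> []" by auto
  let ?e = "last (low q)" and ?f = "hd (high q)"
  have st: "step ?e ?f" using q split is_path_append[OF ne2] by metis
  have rows: "k < fst ?e" "fst ?f < k" 
    using set_low_high(1)[OF last_in_set[OF ne2(1)]] set_low_high(2)[OF hd_in_set[OF ne2(2)]] .
  then have up: "neighbors r \<pi> ?e ?f" "snd ?e = snd ?f" using st by (auto simp: left_step_def up_step_def)
  have "?f \<in> set q" using ne2 split by (metis UnCI hd_in_set set_append)
  then have "?f \<in> nz r \<pi>" "c \<le> snd ?f"
    using q assms(4) path_bounds(3)[OF q \<open>?f \<in> set q\<close>] by (auto simp: is_path_def)
  then have "(k, snd ?f) \<in> nz r \<pi>"
    using rows k_in nz_iff[of "fst ?f" "snd ?f"] by (auto simp: nz_iff c_def)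
  then show False using up rows by (auto simp: neighbors_def)
qed

section \<open>Cutting and merging paths at row \<open>k\<close>\<close>

definition arriving :: "(nat \<times> nat) list \<Rightarrow> bool" where
  "arriving p \<longleftrightarrow> L_path r \<pi> p \<and> k < fst (hd p) \<and> last p = (k, c)"

definition departing :: "(nat \<times> nat) list \<Rightarrow> bool" where
  "departing p \<longleftrightarrow> L_path r \<pi> p \<and> hd p = (k, g) \<and> fst (last p) < k"

text \<open>The last conjunct excludes paths that jump over row \<open>k\<close> in a column to the
  left of \<open>c\<close>.\<close>

definition crossing :: "(nat \<times> nat) list \<Rightarrow> bool" where
  "crossing p \<longleftrightarrow> L_path r \<pi> p \<and> k < fst (hd p) \<and> fst (last p) < k \<and> (\<exists>e\<in>set p. fst e = k)"

text \<open>Used only when \<open>leave b \<le> enter a\<close>; otherwise the middle segment is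
  empty and the two parts are not joined through row \<open>k\<close>.\<close>

definition merge :: "(nat \<times> nat) list \<Rightarrow> (nat \<times> nat) list \<Rightarrow> (nat \<times> nat) list" where
  "merge a b = low a @ row_seg k (leave b) (enter a) @ high b"

definition cut_low :: "(nat \<times> nat) list \<Rightarrow> (nat \<times> nat) list" where
  "cut_low q = low q @ row_seg k c (enter q)"

definition cut_high :: "(nat \<times> nat) list \<Rightarrow> (nat \<times> nat) list" where
  "cut_high q = row_seg k (leave q) g @ high q"

lemma arriving_shape:
  assumes "arriving a"
  shows "a = cut_low a" "low a \<noteq> []" "(k, enter a) \<in> nz r \<pi>" "is_path r \<pi> (low a)"
    "step (last (low a)) (k, enter a)"
proof -
  have a: "is_path r \<pi> a" "k < fst (hd a)" "last a = (k, c)"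
    using assms by (auto simp: arriving_def L_path_def)
  have ne: "a \<noteq> []" using a(1) by (rule is_path_nonempty)
  have e: "(k, c) \<in> set a" using a(3) ne by (metis last_in_set)
  have "\<forall>e\<in>set a. k \<le> fst e" using path_bounds(1)[OF a(1)] a(3) by auto
  then have "high a = []" by (auto simp: high_def filter_empty_conv)
  then have split: "a = low a @ row_seg k (leave a) (enter a)"
    using path_through_row(1)[OF a(1) e] by simp
  note nzs = path_through_row(2-4)[OF a(1) e, simplified]
  note seg = row_seg_path[OF nzs]
  have "last a = (k, leave a)" using seg(3,4) split by (metis last_appendR)
  then have "leave a = c" using a(3) by simp
  then show "a = cut_low a" using split by (simp add: cut_low_def)
  have "hd a \<in> set (low a)" using ne a(2) by (simp add: low_def)
  then show l: "low a \<noteq> []" by auto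
  show "(k, enter a) \<in> nz r \<pi>" by (rule nzs)
  show "is_path r \<pi> (low a)" "step (last (low a)) (k, enter a)"
    using is_path_append[OF l seg(4)] a(1) split seg(2) by metis+
qed

lemma departing_shape:
  assumes "departing b"
  shows "b = cut_high b" "high b \<noteq> []" "(k, leave b) \<in> nz r \<pi>" "is_path r \<pi> (high b)"
    "step (k, leave b) (hd (high b))"
proof -
  have b: "is_path r \<pi> b" "hd b = (k, g)" "fst (last b) < k"
    using assms by (auto simp: departing_def L_path_def)
  have ne: "b \<noteq> []" using b(1) by (rule is_path_nonempty)
  have e: "(k, g) \<in> set b" using b(2) ne by (metis hd_in_set)
  have "\<forall>e\<in>set b. fst e \<le> k" using path_bounds(2)[OF b(1)] b(2) by auto
  then have "low b = []" by (fastforce simp: low_def filter_empty_conv)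
  then have split: "b = row_seg k (leave b) (enter b) @ high b"
    using path_through_row(1)[OF b(1) e] by simp
  note nzs = path_through_row(2-4)[OF b(1) e, simplified]
  note seg = row_seg_path[OF nzs]
  have "hd b = (k, enter b)" using seg(2,4) split by (metis hd_append2)
  then have "enter b = g" using b(2) by simp
  then show "b = cut_high b" using split by (simp add: cut_high_def)
  have "last b \<in> set (high b)" using ne b(3) by (simp add: high_def)
  then show h: "high b \<noteq> []" by auto
  show "(k, leave b) \<in> nz r \<pi>" by (rule nzs)
  show "is_path r \<pi> (high b)" "step (k, leave b) (hd (high b))"
    using is_path_append[OF seg(4) h] b(1) split seg(3) by metis+
qed

lemma crossing_shape:
  assumes "crossing q"
  shows "q = merge q q" "low q \<noteq> []" "high q \<noteq> []" "(k, enter q) \<in> nz r \<pi>" "(k, leave q) \<in> nz r \<pi>"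
    "leave q \<le> enter q" "is_path r \<pi> (low q)" "is_path r \<pi> (high q)"
    "step (last (low q)) (k, enter q)" "step (k, leave q) (hd (high q))"
proof -
  have q: "is_path r \<pi> q" "k < fst (hd q)" "fst (last q) < k"
    using assms by (auto simp: crossing_def L_path_def)
  obtain e where e: "e \<in> set q" "fst e = k" using assms by (auto simp: crossing_def)
  have ne: "q \<noteq> []" using q(1) by (rule is_path_nonempty)
  show m: "q = merge q q" using path_through_row(1)[OF q(1) e] by (simp add: merge_def)
  note nzs = path_through_row(2-4)[OF q(1) e]
  note seg = row_seg_path[OF nzs]
  show "(k, enter q) \<in> nz r \<pi>" "(k, leave q) \<in> nz r \<pi>" "leave q \<le> enter q" by (rule nzs)+
  have "hd q \<in> set (low q)" "last q \<in> set (high q)" using ne q(2,3) by (auto simp: low_def high_def)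
  then show l: "low q \<noteq> []" and h: "high q \<noteq> []" by auto
  have "is_path r \<pi> (low q @ row_seg k (leave q) (enter q) @ high q)" using q(1) m unfolding merge_def by simp
  then show "is_path r \<pi> (low q)" "is_path r \<pi> (high q)"
    "step (last (low q)) (k, enter q)" "step (k, leave q) (hd (high q))"
    using l h seg(2-4) by (simp_all add: is_path_append)
qed

text \<open>Both row segments begin at \<open>(k, j)\<close>, so changing how far left the path runs
  in row \<open>k\<close>, and what follows, does not affect its first step.\<close>

lemma L_path_cong_low:
  assumes "xs \<noteq> []" "L_path r \<pi> (xs @ row_seg k a j @ t)" "is_path r \<pi> (xs @ row_seg k a' j @ t')"
    and nz: "(k, a) \<in> nz r \<pi>" "(k, a') \<in> nz r \<pi>" "(k, j) \<in> nz r \<pi>" "a \<le> j" "a' \<le> j"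
  shows "L_path r \<pi> (xs @ row_seg k a' j @ t')"
proof -
  have "row_seg k a j = (k, j) # tl (row_seg k a j)" "row_seg k a' j = (k, j) # tl (row_seg k a' j)"
    using row_seg_path(2,4) nz by (metis list.collapse)+
  then show ?thesis using L_path_cong_prefix[OF assms(1)] assms(2,3) by (metis append_Cons)
qed

text \<open>The merged path starts as \<open>a\<close> does and so inherits the condition on first
  steps from \<open>a\<close>. The discarded row entries of \<open>a\<close> and \<open>b\<close>
  are recovered by extending the segment to \<open>c\<close> and to \<open>g\<close>
  respectively.\<close>

lemma merge_crossing:
  assumes a: "arriving a" and b: "departing b" and le: "leave b \<le> enter a"
  shows "crossing (merge a b)" "hd (merge a b) = hd a" "last (merge a b) = last b"
    "cut_low (merge a b) = a" "cut_high (merge a b) = b"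
proof -
  note A = arriving_shape[OF a] and B = departing_shape[OF b]
  have nz: "(k, leave b) \<in> nz r \<pi>" "(k, enter a) \<in> nz r \<pi>" using A B by auto
  note seg = row_seg_path[OF nz le]
  have path: "is_path r \<pi> (merge a b)"
    using A B seg by (simp add: merge_def is_path_append)
  have c: "c \<le> enter a" using row_nz(3) A(3) by auto
  have "L_path r \<pi> (low a @ row_seg k c (enter a) @ [])"
    using a A(1) by (simp add: arriving_def cut_low_def)
  then have L: "L_path r \<pi> (merge a b)"
    using path unfolding merge_def by (rule L_path_cong_low[OF A(2)]) (use row_nz nz c le in auto)
  show hd: "hd (merge a b) = hd a" using A(2) arg_cong[OF A(1), of hd] by (simp add: merge_def cut_low_def)
  show last: "last (merge a b) = last b" using B(2) arg_cong[OF B(1), of last] by (simp add: merge_def cut_high_def)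
  have "(k, enter a) \<in> set (merge a b)" using le nz by (auto simp: merge_def set_row_seg row_cols_def)
  then show "crossing (merge a b)"
    using L hd last a b by (force simp: crossing_def arriving_def departing_def)
  have parts: "low (merge a b) = low a" "high (merge a b) = high b" "enter (merge a b) = enter a"
    "leave (merge a b) = leave b"
    unfolding merge_def by (rule row_parts[OF _ _ nz le]; simp add: set_low_high)+
  show "cut_low (merge a b) = a" "cut_high (merge a b) = b"
    using A(1) B(1) parts by (simp_all add: cut_low_def cut_high_def)
qed

lemma cut_low_arriving:
  assumes q: "crossing q"
  shows "arriving (cut_low q)" "hd (cut_low q) = hd q" "low (cut_low q) = low q" "enter (cut_low q) = enter q"
proof -
  note Q = crossing_shape[OF q]
  have c: "c \<le> enter q" using row_nz(3) Q(4) by auto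
  note seg = row_seg_path[OF row_nz(1) Q(4) c]
  have path: "is_path r \<pi> (low q @ row_seg k c (enter q) @ [])"
    using Q seg by (simp add: is_path_append)
  have "L_path r \<pi> (low q @ row_seg k (leave q) (enter q) @ high q)"
    using q Q(1) by (simp add: crossing_def merge_def)
  then have "L_path r \<pi> (low q @ row_seg k c (enter q) @ [])"
    using path by (rule L_path_cong_low[OF Q(2)]) (use row_nz Q c in auto)
  then have L: "L_path r \<pi> (cut_low q)" by (simp add: cut_low_def)
  show hd: "hd (cut_low q) = hd q" using Q(2) arg_cong[OF Q(1), of hd] by (simp add: merge_def cut_low_def)
  have "last (cut_low q) = (k, c)" using seg by (simp add: cut_low_def)
  then show "arriving (cut_low q)" using L hd q by (simp add: arriving_def crossing_def)
  show "low (cut_low q) = low q" "enter (cut_low q) = enter q"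
    using row_parts(1,3)[OF _ _ row_nz(1) Q(4) c, of "low q" "[]"] set_low_high(1)
    by (auto simp: cut_low_def)
qed

text \<open>Unlike \<open>cut_low q\<close>, this path has a new origin \<open>(k, g)\<close>. If
  \<open>g = r\<close>, its first step must be shown to go left, and this is where the condition on
  the first step of \<open>q\<close> is needed.\<close>

lemma cut_high_departing:
  assumes q: "crossing q"
  shows "departing (cut_high q)" "last (cut_high q) = last q" "high (cut_high q) = high q"
    "leave (cut_high q) = leave q"
proof -
  note Q = crossing_shape[OF q]
  have g: "leave q \<le> g" using row_nz(3) Q(5) by auto
  note seg = row_seg_path[OF Q(5) row_nz(2) g]
  have path: "is_path r \<pi> (cut_high q)"
    using Q seg by (simp add: is_path_append cut_high_def)
  have hd: "hd (cut_high q) = (k, g)" using seg by (simp add: cut_high_def)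
  have "left_step r \<pi> (cut_high q ! 0) (cut_high q ! 1)" if len: "length (cut_high q) - 1 \<ge> 1" and gr: "g = r"
  proof -
    have "leave q \<noteq> g"
    \<comment> \<open>otherwise \<open>q\<close> runs up column \<open>r\<close> from its origin, against the condition on first steps\<close>
    proof
      assume lg: "leave q = g"
      then have eg: "enter q = g" using Q(6) row_nz(3)[OF Q(4)] by auto
      have L: "L_path r \<pi> q" using q by (simp add: crossing_def)
      have "(k, enter q) \<in> set (merge q q)" using Q(4,6) by (auto simp: merge_def set_row_seg row_cols_def)
      then have in_q: "(k, enter q) \<in> set q" using Q(1) by simp
      have ne: "q \<noteq> []" using is_path_nonempty[OF L_path_is_path[OF L]] .
      have "r \<le> snd (hd q)" using path_bounds(4)[OF L_path_is_path[OF L] in_q] eg gr by simp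
      moreover have "hd q \<in> nz r \<pi>"
        using L_path_is_path[OF L] hd_in_set[OF ne] unfolding is_path_def by blast
      ultimately have r: "snd (hd q) = r" using nz_iff[of "fst (hd q)" "snd (hd q)"] by auto
      \<comment> \<open>The first step of \<open>q\<close> takes place inside this prefix. It is a
        path ending in column \<open>r\<close>, so all its entries are in column \<open>r\<close> or
        further right, and its first step cannot go left.\<close>
      let ?xs = "low q @ [(k, enter q)]"
      have pre: "is_path r \<pi> ?xs" using Q by (auto simp: is_path_append) (auto simp: is_path_def)
      have "row_seg k (leave q) (enter q) = [(k, enter q)]"
        using lg eg row_nz(2) row_path_unique[of "[(k, g)]" k] by (simp add: is_path_def)
      then have q_eq: "q = ?xs @ high q" using Q(1) by (simp add: merge_def)
      have two: "1 < length ?xs" using Q(2) by simp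
      have "length q - 1 \<ge> 1" using two arg_cong[OF q_eq, of length] by (cases "low q") auto
      then have "left_step r \<pi> (q ! 0) (q ! 1)" using L r by (simp add: L_path_def)
      then have "snd (q ! 1) < r" using r ne by (auto simp: left_step_def hd_conv_nth)
      moreover have "q ! 1 = ?xs ! 1" using q_eq two by (metis nth_append)
      moreover have "?xs ! 1 \<in> set ?xs" using two by (rule nth_mem)
      ultimately show False using path_bounds(3)[OF pre, of "?xs ! 1"] eg gr by simp
    qed
    then have lt: "leave q < g" using g by simp
    \<comment> \<open>Two distinct columns in the initial row segment keep the first step inside row
      \<open>k\<close>, hence make it a left step.\<close>
    have "(k, leave q) \<in> set (row_seg k (leave q) g)" "(k, g) \<in> set (row_seg k (leave q) g)"
      using Q(5) row_nz(2) g by (auto simp: set_row_seg row_cols_def)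
    then have two: "1 < length (row_seg k (leave q) g)"
      using lt by (cases "row_seg k (leave q) g"; cases "tl (row_seg k (leave q) g)") auto
    have eq: "cut_high q ! i = row_seg k (leave q) g ! i" if "i \<le> 1" for i
      using two that by (simp add: cut_high_def nth_append)
    have "row_seg k (leave q) g ! i \<in> Pair k ` row_cols k (leave q) g" if "i \<le> 1" for i
      using two that nth_mem[of i "row_seg k (leave q) g"] by (simp add: set_row_seg)
    then have row: "fst (cut_high q ! i) = k" if "i \<le> 1" for i
      using eq[OF that] that by (metis fst_conv imageE)
    have "step (cut_high q ! 0) (cut_high q ! Suc 0)"
      using path len unfolding is_path_def successively_conv_nth by simp
    then show ?thesis using row[of 0] row[of 1] by (simp add: up_step_def)
  qed
  then have L: "L_path r \<pi> (cut_high q)" unfolding L_path_def hd snd_conv using path by blast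
  show last: "last (cut_high q) = last q" using Q(3) arg_cong[OF Q(1), of last] by (simp add: merge_def cut_high_def)
  show "departing (cut_high q)" using L hd last q by (simp add: departing_def crossing_def)
  show "high (cut_high q) = high q" "leave (cut_high q) = leave q"
    using row_parts(2,4)[OF _ _ Q(5) row_nz(2) g, of "[]" "high q"] set_low_high(2)
    by (auto simp: cut_high_def)
qed

lemma merge_cut: "crossing q \<Longrightarrow> merge (cut_low q) (cut_high q) = q"
  using crossing_shape(1) cut_low_arriving(3,4) cut_high_departing(3,4) by (metis merge_def)

end

subsection \<open>Families of disjoint paths cut at a row\<close>

lemma bij_betw_restrict:
  assumes "bij_betw f P A" "A' \<subseteq> A"
  shows "f ` {p \<in> P. f p \<in> A'} = A'"
  using assms by (fastforce simp: bij_betw_def)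

lemma disjoint_paths_L_remove:
  assumes P: "P \<in> disjoint_paths_L r \<pi> A B" and p: "p \<in> P"
  shows "P - {p} \<in> disjoint_paths_L r \<pi> (A - {hd p}) (B - {last p})"
    "set p \<inter> verts (P - {p}) = {}"
proof -
  have "hd ` (P - {p}) = A - {hd p}" "last ` (P - {p}) = B - {last p}"
    using P p inj_on_image_set_diff[of hd P P "{p}"] inj_on_image_set_diff[of last P P "{p}"]
    by (auto simp: disjoint_paths_L_iff bij_betw_def)
  then show "P - {p} \<in> disjoint_paths_L r \<pi> (A - {hd p}) (B - {last p})"
    using disjoint_paths_L_subset[OF P, of "P - {p}"] by auto
  show "set p \<inter> verts (P - {p}) = {}"
    using disjoint_paths_L_disjnt[OF P, of "{p}" "P - {p}"] p by (simp add: verts_def)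
qed

context perm_entries
begin

lemma path_in_fam:
  assumes "P \<in> disjoint_paths_L r \<pi> A B" "p \<in> P"
  shows "L_path r \<pi> p" "is_path r \<pi> p" "hd p \<in> A" "last p \<in> B" "fst (last p) \<le> fst (hd p)"
proof -
  show "L_path r \<pi> p" and p: "is_path r \<pi> p" and "hd p \<in> A" "last p \<in> B"
    using assms by (auto simp: disjoint_paths_L_iff L_path_def bij_betw_def)
  show "fst (last p) \<le> fst (hd p)"
    using path_bounds(1)[OF p hd_in_set[OF is_path_nonempty[OF p]]] .
qed

lemma verts_bounds:
  assumes "P \<in> disjoint_paths_L r \<pi> A B" "e \<in> verts P"
  shows "\<exists>a\<in>A. fst e \<le> fst a" "\<exists>b\<in>B. fst b \<le> fst e"
proof -
  obtain p where p: "p \<in> P" "e \<in> set p" using assms(2) by (auto simp: verts_def)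
  then have "is_path r \<pi> p" "hd p \<in> A" "last p \<in> B"
    using assms(1) by (auto simp: disjoint_paths_L_iff L_path_def bij_betw_def)
  then show "\<exists>a\<in>A. fst e \<le> fst a" "\<exists>b\<in>B. fst b \<le> fst e" using path_bounds p(2) by blast+
qed

end

text \<open>The sets are the origins and endpoints strictly below and strictly above row
  \<open>k\<close>. The excess of one endpoint above the row forces a path from below to end above
  it, and the column condition on \<open>Du\<close> prevents that path from jumping over the
  row.\<close>

locale cut_families = row_cut +
  fixes Ol Ou Dl Du :: "(nat \<times> nat) set"
  assumes Ol: "\<And>e. e \<in> Ol \<Longrightarrow> k < fst e" and Ou: "\<And>e. e \<in> Ou \<Longrightarrow> fst e < k"
    and Dl: "\<And>e. e \<in> Dl \<Longrightarrow> k < fst e" and Du: "\<And>e. e \<in> Du \<Longrightarrow> fst e < k \<and> c \<le> snd e"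
    and fin: "finite Ou" "finite Du" and cards: "card Du = Suc (card Ou)"
begin

abbreviation "low_fams \<equiv> disjoint_paths_L r \<pi> Ol (insert (k, c) Dl)"
abbreviation "high_fams \<equiv> disjoint_paths_L r \<pi> (insert (k, g) Ou) Du"
abbreviation "full_fams \<equiv> disjoint_paths_L r \<pi> (Ol \<union> insert (k, g) Ou) (insert (k, c) Dl \<union> Du)"
abbreviation "cross_fams \<equiv> disjoint_paths_L r \<pi> (Ol \<union> Ou) (Dl \<union> Du)"

text \<open>\<open>R\<close> (resp. \<open>S\<close>) is what remains of a family below (resp. above) row \<open>k\<close> when its unique
  path \<open>p\<close> meeting that row is removed.\<close>

definition low_rest :: "(nat \<times> nat) list \<Rightarrow> (nat \<times> nat) list set \<Rightarrow> bool" where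
  "low_rest p R \<longleftrightarrow> hd p \<in> Ol \<and> R \<in> disjoint_paths_L r \<pi> (Ol - {hd p}) Dl \<and> set p \<inter> verts R = {}"

definition high_rest :: "(nat \<times> nat) list \<Rightarrow> (nat \<times> nat) list set \<Rightarrow> bool" where
  "high_rest p S \<longleftrightarrow> last p \<in> Du \<and> S \<in> disjoint_paths_L r \<pi> Ou (Du - {last p}) \<and> set p \<inter> verts S = {}"

lemma low_rest_rows:
  assumes "low_rest p R"
  shows "\<And>e. e \<in> verts R \<Longrightarrow> k < fst e" "\<And>q. q \<in> R \<Longrightarrow> k < fst (hd q) \<and> k < fst (last q)"
proof -
  have R: "R \<in> disjoint_paths_L r \<pi> (Ol - {hd p}) Dl" using assms by (simp add: low_rest_def)
  show "k < fst e" if "e \<in> verts R" for e using verts_bounds(2)[OF R that] Dl by force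
  show "k < fst (hd q) \<and> k < fst (last q)" if "q \<in> R" for q
    using path_in_fam[OF R that] Ol Dl by blast
qed

lemma high_rest_rows:
  assumes "high_rest p S"
  shows "\<And>e. e \<in> verts S \<Longrightarrow> fst e < k" "\<And>q. q \<in> S \<Longrightarrow> fst (hd q) < k \<and> fst (last q) < k"
proof -
  have S: "S \<in> disjoint_paths_L r \<pi> Ou (Du - {last p})" using assms by (simp add: high_rest_def)
  show "fst e < k" if "e \<in> verts S" for e using verts_bounds(1)[OF S that] Ou by force
  show "fst (hd q) < k \<and> fst (last q) < k" if "q \<in> S" for q
    using path_in_fam[OF S that] Ou Du by blast
qed

text \<open>The path ending at \<open>(k, c)\<close> starts in \<open>Ol\<close>, hence strictly
  below the row, so it is arriving. The other paths end in \<open>Dl\<close> and stay below row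
  \<open>k\<close>.\<close>

lemma low_fams_iff:
  "P \<in> low_fams \<longleftrightarrow> (\<exists>a R. P = insert a R \<and> arriving a \<and> low_rest a R)"
proof
  assume P: "P \<in> low_fams"
  then have "(k, c) \<in> last ` P" by (simp add: disjoint_paths_L_iff bij_betw_def)
  then obtain a where a: "a \<in> P" "last a = (k, c)" by (metis imageE)
  have "arriving a" using path_in_fam[OF P a(1)] Ol a(2) by (auto simp: arriving_def)
  moreover have "insert (k, c) Dl - {(k, c)} = Dl" using Dl by force
  then have "low_rest a (P - {a})"
    using disjoint_paths_L_remove[OF P a(1)] path_in_fam[OF P a(1)] a(2) by (simp add: low_rest_def)
  moreover have "P = insert a (P - {a})" using a(1) by auto
  ultimately show "\<exists>a R. P = insert a R \<and> arriving a \<and> low_rest a R" by blast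
next
  assume "\<exists>a R. P = insert a R \<and> arriving a \<and> low_rest a R"
  then obtain a R where P: "P = insert a R" and a: "arriving a" and R: "low_rest a R" by blast
  have "insert a R \<in> disjoint_paths_L r \<pi> (insert (hd a) (Ol - {hd a})) (insert (last a) Dl)"
    using a R by (intro disjoint_paths_L_insert) (auto simp: low_rest_def arriving_def)
  then show "P \<in> low_fams"
    using P a R by (simp add: low_rest_def arriving_def insert_absorb)
qed

lemma high_fams_iff:
  "P \<in> high_fams \<longleftrightarrow> (\<exists>b S. P = insert b S \<and> departing b \<and> high_rest b S)"
proof
  assume P: "P \<in> high_fams"
  then have "(k, g) \<in> hd ` P" by (simp add: disjoint_paths_L_iff bij_betw_def)
  then obtain b where b: "b \<in> P" "hd b = (k, g)" by (metis imageE)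
  have "departing b" using path_in_fam[OF P b(1)] Du b(2) by (auto simp: departing_def)
  moreover have "insert (k, g) Ou - {(k, g)} = Ou" using Ou by force
  then have "high_rest b (P - {b})"
    using disjoint_paths_L_remove[OF P b(1)] path_in_fam[OF P b(1)] b(2) by (simp add: high_rest_def)
  moreover have "P = insert b (P - {b})" using b(1) by auto
  ultimately show "\<exists>b S. P = insert b S \<and> departing b \<and> high_rest b S" by blast
next
  assume "\<exists>b S. P = insert b S \<and> departing b \<and> high_rest b S"
  then obtain b S where P: "P = insert b S" and b: "departing b" and S: "high_rest b S" by blast
  have "insert b S \<in> disjoint_paths_L r \<pi> (insert (hd b) Ou) (insert (last b) (Du - {last b}))"
    using b S by (intro disjoint_paths_L_insert) (auto simp: high_rest_def departing_def)
  then show "P \<in> high_fams"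
    using P b S by (simp add: high_rest_def departing_def insert_absorb)
qed

text \<open>Paths from \<open>Ou\<close> stay above row \<open>k\<close>, so they end in
  \<open>Du\<close>. By \<open>cards\<close> exactly one further path ends in \<open>Du\<close>; it
  starts in \<open>Ol\<close> and must meet row \<open>k\<close>. The remaining paths lead from
  \<open>Ol\<close> to \<open>Dl\<close>.\<close>

lemma cross_fams_iff:
  "Q \<in> cross_fams \<longleftrightarrow>
     (\<exists>q R S. Q = insert q (R \<union> S) \<and> crossing q \<and> low_rest q R \<and> high_rest q S)"
proof
  assume Q: "Q \<in> cross_fams"
  \<comment> \<open>\<open>W\<close> plays the part of \<open>S\<close>, and the single element of
    \<open>U - W\<close> is the crossing path.\<close>
  define U W R where "U = {p \<in> Q. last p \<in> Du}" and "W = {p \<in> Q. hd p \<in> Ou}"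
    and "R = {p \<in> Q. last p \<in> Dl}"
  have bij: "bij_betw hd Q (Ol \<union> Ou)" "bij_betw last Q (Dl \<union> Du)"
    using Q by (auto simp: disjoint_paths_L_iff)
  have im: "last ` U = Du" "hd ` W = Ou" "last ` R = Dl"
    unfolding U_def W_def R_def
    using bij_betw_restrict[OF bij(2), of Du] bij_betw_restrict[OF bij(1), of Ou]
      bij_betw_restrict[OF bij(2), of Dl] by auto
  have inj: "inj_on hd Q" "inj_on last Q" using bij by (auto simp: bij_betw_def)
  have sub: "U \<subseteq> Q" "W \<subseteq> Q" "R \<subseteq> Q" by (auto simp: U_def W_def R_def)
  have WU: "W \<subseteq> U"
  proof
    fix p assume "p \<in> W"
    then have p: "p \<in> Q" "hd p \<in> Ou" by (auto simp: W_def)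
    have "fst (last p) < k" using path_in_fam(5)[OF Q p(1)] Ou[OF p(2)] by simp
    then have "last p \<notin> Dl" using Dl by fastforce
    then show "p \<in> U" using p path_in_fam(4)[OF Q p(1)] by (auto simp: U_def)
  qed
  have cU: "card U = card Du" "card W = card Ou"
    using card_image[OF inj_on_subset[OF inj(2) sub(1)]] card_image[OF inj_on_subset[OF inj(1) sub(2)]] im
    by auto
  have "finite U" using im(1) fin(2) finite_imageD[OF _ inj_on_subset[OF inj(2) sub(1)]] by simp
  then have "card (U - W) = 1" using cU cards WU by (simp add: card_Diff_subset finite_subset)
  then obtain q where q: "U - W = {q}" by (auto simp: card_1_singleton_iff)
  then have U: "U = insert q W" "q \<notin> W" "q \<in> Q" using WU sub(1) by auto
  have qends: "hd q \<in> Ol" "last q \<in> Du"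
    using q path_in_fam(3)[OF Q U(3)] by (auto simp: U_def W_def)
  have eq: "Q = insert q (R \<union> W)"
    using U path_in_fam(4)[OF Q] by (auto simp: R_def U_def W_def)
  have qR: "q \<notin> R" using qends(2) Dl Du by (fastforce simp: R_def)
  have RW: "R \<inter> W = {}" using WU Dl Du by (fastforce simp: R_def U_def)
  have R_eq: "R = Q - {q} - W" using eq qR RW U by auto
  have "hd ` Q = Ol \<union> Ou" using bij by (simp add: bij_betw_def)
  moreover have "Ol \<inter> Ou = {}" using Ol Ou by fastforce
  ultimately have hdR: "hd ` R = Ol - {hd q}"
    unfolding R_eq using inj(1) sub(2) U im(2) qends(1)
    by (subst inj_on_image_set_diff[OF inj(1)], blast, blast,
        subst inj_on_image_set_diff[OF inj(1)], blast, blast) auto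
  have "W = U - {q}" using U by auto
  then have lastW: "last ` W = Du - {last q}"
    using im(1) inj_on_image_set_diff[OF inj(2), of U "{q}"] sub U(3) by auto
  have R: "R \<in> disjoint_paths_L r \<pi> (Ol - {hd q}) Dl"
    using disjoint_paths_L_subset[OF Q sub(3)] hdR im(3) by simp
  have W: "W \<in> disjoint_paths_L r \<pi> Ou (Du - {last q})"
    using disjoint_paths_L_subset[OF Q sub(2)] lastW im(2) by simp
  have "set q \<inter> verts R = {}" "set q \<inter> verts W = {}"
    using disjoint_paths_L_disjnt[OF Q, of "{q}" R] disjoint_paths_L_disjnt[OF Q, of "{q}" W]
      U qR sub by (auto simp: verts_def)
  moreover have "crossing q"
    using path_in_fam[OF Q U(3)] qends Ol Du crossing_path_meets_row[of q] by (auto simp: crossing_def)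
  ultimately show "\<exists>q R S. Q = insert q (R \<union> S) \<and> crossing q \<and> low_rest q R \<and> high_rest q S"
    using eq R W qends unfolding low_rest_def high_rest_def by blast
next
  assume "\<exists>q R S. Q = insert q (R \<union> S) \<and> crossing q \<and> low_rest q R \<and> high_rest q S"
  then obtain q R S where Q: "Q = insert q (R \<union> S)" and q: "crossing q"
    and R: "low_rest q R" and S: "high_rest q S" by blast
  have "verts R \<inter> verts S = {}" using low_rest_rows(1)[OF R] high_rest_rows(1)[OF S] by fastforce
  then have "R \<union> S \<in> disjoint_paths_L r \<pi> ((Ol - {hd q}) \<union> Ou) (Dl \<union> (Du - {last q}))"
    using R S by (intro disjoint_paths_L_Un) (auto simp: low_rest_def high_rest_def)
  then have "insert q (R \<union> S) \<in>
      disjoint_paths_L r \<pi> (insert (hd q) ((Ol - {hd q}) \<union> Ou)) (insert (last q) (Dl \<union> (Du - {last q})))"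
    using q R S by (intro disjoint_paths_L_insert) (auto simp: low_rest_def high_rest_def crossing_def)
  moreover have "insert (hd q) ((Ol - {hd q}) \<union> Ou) = Ol \<union> Ou"
    "insert (last q) (Dl \<union> (Du - {last q})) = Dl \<union> Du"
    using R S by (auto simp: low_rest_def high_rest_def)
  ultimately show "Q \<in> cross_fams" using Q by simp
qed

text \<open>The paths starting at \<open>(k, g)\<close> or in \<open>Ou\<close> are as many as the
  elements of \<open>Du\<close>, and never descend. Once \<open>(k, c)\<close> is excluded as an
  endpoint, they exhaust \<open>Du\<close> by counting, which leaves \<open>(k, c)\<close> and
  \<open>Dl\<close> to the paths from \<open>Ol\<close>.\<close>

lemma full_fam_split:
  assumes P: "P \<in> full_fams"
  shows "{p \<in> P. k < fst (hd p)} \<in> low_fams" "{p \<in> P. \<not> k < fst (hd p)} \<in> high_fams"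
proof -
  let ?P1 = "{p \<in> P. k < fst (hd p)}" and ?P2 = "{p \<in> P. \<not> k < fst (hd p)}"
  have bij: "bij_betw hd P (Ol \<union> insert (k, g) Ou)" "bij_betw last P (insert (k, c) Dl \<union> Du)"
    using P by (auto simp: disjoint_paths_L_iff)
  have hdP: "hd p \<in> Ol \<union> insert (k, g) Ou" if "p \<in> P" for p using path_in_fam(3)[OF P that] .
  have hd_iff: "k < fst (hd p) \<longleftrightarrow> hd p \<in> Ol" "\<not> k < fst (hd p) \<longleftrightarrow> hd p \<in> insert (k, g) Ou"
    if "p \<in> P" for p
    using hdP[OF that] Ol[of "hd p"] Ou[of "hd p"] by auto
  have hd2: "hd ` ?P2 = insert (k, g) Ou" and hd1: "hd ` ?P1 = Ol"
  proof -
    have "?P2 = {p \<in> P. hd p \<in> insert (k, g) Ou}" "?P1 = {p \<in> P. hd p \<in> Ol}"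
      using hd_iff by blast+
    then show "hd ` ?P2 = insert (k, g) Ou" "hd ` ?P1 = Ol"
      using bij_betw_restrict[OF bij(1), of "insert (k, g) Ou"] bij_betw_restrict[OF bij(1), of Ol] by auto
  qed
  have inj: "inj_on hd P" "inj_on last P" using bij by (auto simp: bij_betw_def)
  have "(k, g) \<notin> Ou" using Ou by force
  then have "card ?P2 = card Du"
    using card_image[OF inj_on_subset[OF inj(1)], of ?P2] hd2 fin(1) cards by simp
  then have c2: "card (last ` ?P2) = card Du"
    using card_image[OF inj_on_subset[OF inj(2)], of ?P2] by simp
  have sub2: "last ` ?P2 \<subseteq> insert (k, c) Du"
  proof (rule image_subsetI)
    fix p assume "p \<in> ?P2"
    then have p: "p \<in> P" "fst (last p) \<le> k" using path_in_fam(5)[OF P, of p] by auto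
    then show "last p \<in> insert (k, c) Du"
      using path_in_fam(4)[OF P p(1)] Dl[of "last p"] by auto
  qed
  have "(k, c) \<notin> last ` ?P2"
  \<comment> \<open>otherwise one path fills the whole of row \<open>k\<close>, and by cardinality another one has to cross that row\<close>
  proof
    assume "(k, c) \<in> last ` ?P2"
    then obtain p where p: "p \<in> P" "\<not> k < fst (hd p)" "last p = (k, c)" by fastforce
    have hp: "hd p = (k, g)"
      using p path_in_fam(5)[OF P p(1)] hdP[OF p(1)] Ol[of "hd p"] Ou[of "hd p"] by auto
    have path: "is_path r \<pi> p" using path_in_fam(2)[OF P p(1)] .
    have "\<forall>e\<in>set p. fst e = k"
      using path_bounds(1,2)[OF path] hp p(3) by (metis fst_conv le_antisym)
    from row_path_unique[OF path this] have pseg: "p = row_seg k c g" using hp p(3) by simp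
    have "(k, c) \<notin> Du" using Du by force
    have "\<not> Du \<subseteq> last ` ?P2"
    proof
      assume "Du \<subseteq> last ` ?P2"
      then have "insert (k, c) Du \<subseteq> last ` ?P2" using \<open>(k, c) \<in> last ` ?P2\<close> by blast
      moreover have "finite (last ` ?P2)" using sub2 fin(2) finite_subset by blast
      ultimately have "card (insert (k, c) Du) \<le> card (last ` ?P2)" by (intro card_mono)
      then show False using c2 \<open>(k, c) \<notin> Du\<close> fin(2) by simp
    qed
    then obtain x where x: "x \<in> Du" "x \<notin> last ` ?P2" by blast
    have "last ` P = insert (k, c) Dl \<union> Du" using bij by (simp add: bij_betw_def)
    then obtain q where q: "q \<in> P" "last q = x" using x(1) by (metis UnI2 imageE)
    then have "k < fst (hd q)" using x(2) by blast
    then obtain e where e: "e \<in> set q" "fst e = k"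
      using crossing_path_meets_row[OF path_in_fam(2)[OF P q(1)]] Du[OF x(1)] q(2) by blast
    have "e \<in> nz r \<pi>" using path_in_fam(2)[OF P q(1)] e(1) by (auto simp: is_path_def)
    then have "e \<in> set p" using row_nz(3)[of "snd e"] e(2)
      unfolding pseg set_row_seg row_cols_def by (metis (mono_tags, lifting) image_eqI mem_Collect_eq prod.collapse)
    moreover have "p \<noteq> q" using p(3) q(2) Du[OF x(1)] by force
    moreover from this have "disjnt (set p) (set q)"
      using P p(1) q(1) by (simp add: disjoint_paths_L_iff pairwise_def)
    ultimately show False using e(1) by (auto simp: disjnt_def)
  qed
  from subset_insert[OF this, THEN iffD1, OF sub2] have "last ` ?P2 \<subseteq> Du" .
  then have last2: "last ` ?P2 = Du" by (rule card_subset_eq[OF fin(2) _ c2])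
  have "?P1 = P - ?P2" by auto
  then have "last ` ?P1 = (insert (k, c) Dl \<union> Du) - Du"
    using inj_on_image_set_diff[OF inj(2), of P ?P2] last2 bij_betw_imp_surj_on[OF bij(2)]
    by (simp only: order_refl) blast
  also have "\<dots> = insert (k, c) Dl" using Du Dl by force
  finally have last1: "last ` ?P1 = insert (k, c) Dl" .
  show "?P1 \<in> low_fams" "?P2 \<in> high_fams"
    using disjoint_paths_L_subset[OF P, of ?P1] disjoint_paths_L_subset[OF P, of ?P2]
    by (simp_all only: hd1 hd2 last1 last2) blast+
qed

end

section \<open>Exchange of meeting families and its effect on weights\<close>

context row_cut
begin

text \<open>The entry \<open>(k, c)\<close> is not free, so it is absent from the weight; in
  \<open>rho\<close> it contributes a factor 1.\<close>

lemma weight_row: "weight r \<pi> (Pair k ` row_cols k c g) = (rho r \<pi> (k, c) :: 'a::comm_ring_1 mpoly)"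
proof -
  let ?R = "{j. (k, j) \<in> nz r \<pi>}"
  have R: "row_cols k c g = ?R" using row_nz(3) by (auto simp: row_cols_def)
  have "free_entries r \<pi> \<inter> Pair k ` ?R = Pair k ` (?R - {c})"
  proof -
    have "(k, j) \<in> free_entries r \<pi> \<longleftrightarrow> j \<noteq> c" if "(k, j) \<in> nz r \<pi>" for j
      using that by (auto simp: nz_def one_entries_def one_entry_def c_def free_entries_def Inv_def)
    then show ?thesis by auto
  qed
  then have "weight r \<pi> (Pair k ` row_cols k c g) = (\<Prod>(i, j)\<in>Pair k ` (?R - {c}). wn r \<pi> i j :: 'a mpoly)"
    unfolding weight_def R by (simp add: Int_commute)
  also have "\<dots> = (\<Prod>j\<in>?R - {c}. wn r \<pi> k j)"
    by (subst prod.reindex) (auto simp: inj_on_def)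
  also have "\<dots> = (\<Prod>j\<in>?R. wn r \<pi> k j)"
    using finite_row_cols[of k c g] unfolding R
    by (intro prod.mono_neutral_left) (auto simp: wn_def nmat_def c_def)
  finally show ?thesis by (simp add: rho_def)
qed

end

context cut_families
begin

text \<open>On the pairs considered, the product of the last two sets is the singleton
  \<open>{(a, b)}\<close> of the arriving and the departing path. Taking an image over it avoids
  choosing them.\<close>

definition exchange :: "(nat \<times> nat) list set \<times> (nat \<times> nat) list set \<Rightarrow> (nat \<times> nat) list set" where
  "exchange = (\<lambda>(P1, P2). {p \<in> P1. k < fst (last p)} \<union> {p \<in> P2. fst (hd p) < k} \<union>
     (\<lambda>(a, b). merge a b) ` ({p \<in> P1. \<not> k < fst (last p)} \<times> {p \<in> P2. \<not> fst (hd p) < k}))"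

definition unexchange :: "(nat \<times> nat) list set \<Rightarrow> (nat \<times> nat) list set \<times> (nat \<times> nat) list set" where
  "unexchange Q = (cut_low ` {p \<in> Q. crossing p} \<union> {p \<in> Q. k < fst (last p)},
     cut_high ` {p \<in> Q. crossing p} \<union> {p \<in> Q. fst (hd p) < k})"

lemma exchange_insert:
  assumes "arriving a" "low_rest a R" "departing b" "high_rest b S"
  shows "exchange (insert a R, insert b S) = insert (merge a b) (R \<union> S)"
proof -
  have "{p \<in> insert a R. k < fst (last p)} = R" "{p \<in> insert b S. fst (hd p) < k} = S"
    "{p \<in> insert a R. \<not> k < fst (last p)} = {a}" "{p \<in> insert b S. \<not> fst (hd p) < k} = {b}"
    using assms(1,3) low_rest_rows(2)[OF assms(2)] high_rest_rows(2)[OF assms(4)]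
    by (auto simp: arriving_def departing_def)
  then show ?thesis unfolding exchange_def by auto
qed

lemma unexchange_insert:
  assumes "crossing q" "low_rest q R" "high_rest q S"
  shows "unexchange (insert q (R \<union> S)) = (insert (cut_low q) R, insert (cut_high q) S)"
proof -
  have "{p \<in> insert q (R \<union> S). crossing p} = {q}"
    "{p \<in> insert q (R \<union> S). k < fst (last p)} = R" "{p \<in> insert q (R \<union> S). fst (hd p) < k} = S"
    using assms(1) low_rest_rows(2)[OF assms(2)] high_rest_rows(2)[OF assms(3)]
    by (auto simp: crossing_def dest: less_asym less_trans)
  then show ?thesis unfolding unexchange_def by auto
qed

lemma set_parts:
  "arriving a \<Longrightarrow> set a = set (low a) \<union> Pair k ` row_cols k c (enter a)"
  "departing b \<Longrightarrow> set b = Pair k ` row_cols k (leave b) g \<union> set (high b)"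
  using arg_cong[OF arriving_shape(1), of a set] arg_cong[OF departing_shape(1), of b set]
  by (auto simp: cut_low_def cut_high_def set_row_seg)

lemma rest_disjoint:
  "low_rest p R \<Longrightarrow> e \<in> set p \<Longrightarrow> e \<notin> verts R" "high_rest p S \<Longrightarrow> e \<in> set p \<Longrightarrow> e \<notin> verts S"
  by (auto simp: low_rest_def high_rest_def)

text \<open>Below row \<open>k\<close> the merged path consists of entries of \<open>a\<close>,
  above it of entries of \<open>b\<close>. Since \<open>R\<close> stays below and \<open>S\<close>
  above the row, disjointness is inherited.\<close>

lemma merge_rests:
  assumes a: "arriving a" "low_rest a R" and b: "departing b" "high_rest b S" and le: "leave b \<le> enter a"
  shows "low_rest (merge a b) R" "high_rest (merge a b) S"
proof -
  have mem: "e \<in> set a \<or> fst e \<le> k" "e \<in> set b \<or> k \<le> fst e" if "e \<in> set (merge a b)" for e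
    using that by (auto simp: merge_def set_row_seg low_def high_def)
  have "e \<notin> verts R" if "e \<in> set (merge a b)" for e
    using mem(1)[OF that] rest_disjoint(1)[OF a(2), of e] low_rest_rows(1)[OF a(2), of e] by auto
  moreover have "e \<notin> verts S" if "e \<in> set (merge a b)" for e
    using mem(2)[OF that] rest_disjoint(2)[OF b(2), of e] high_rest_rows(1)[OF b(2), of e] by auto
  ultimately show "low_rest (merge a b) R" "high_rest (merge a b) S"
    using a(2) b(2) merge_crossing(2,3)[OF a(1) b(1) le] unfolding low_rest_def high_rest_def disjoint_iff by simp_all
qed

lemma cut_rests:
  assumes q: "crossing q" and R: "low_rest q R" and S: "high_rest q S"
  shows "low_rest (cut_low q) R" "high_rest (cut_high q) S"
proof -
  have mem: "e \<in> set q \<or> fst e = k" if "e \<in> set (cut_low q) \<union> set (cut_high q)" for e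
    using that by (auto simp: cut_low_def cut_high_def set_row_seg low_def high_def)
  have "e \<notin> verts R" if "e \<in> set (cut_low q)" for e
    using mem[of e] that rest_disjoint(1)[OF R, of e] low_rest_rows(1)[OF R, of e] by auto
  moreover have "e \<notin> verts S" if "e \<in> set (cut_high q)" for e
    using mem[of e] that rest_disjoint(2)[OF S, of e] high_rest_rows(1)[OF S, of e] by auto
  ultimately show "low_rest (cut_low q) R" "high_rest (cut_high q) S"
    using R S cut_low_arriving(2)[OF q] cut_high_departing(2)[OF q]
    unfolding low_rest_def high_rest_def disjoint_iff by simp_all
qed

text \<open>Row \<open>k\<close> separates the rest of the two families. Inside it the first
  occupies columns \<open>c\<close> to \<open>enter a\<close> and the second columns
  \<open>leave b\<close> to \<open>g\<close>.\<close>

lemma verts_Int: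
  assumes a: "arriving a" "low_rest a R" and b: "departing b" "high_rest b S"
  shows "verts (insert a R) \<inter> verts (insert b S) = Pair k ` row_cols k (leave b) (enter a)"
proof -
  have "c \<le> leave b" "enter a \<le> g"
    using row_nz(3) arriving_shape(3)[OF a(1)] departing_shape(3)[OF b(1)] by auto
  then have rows: "row_cols k c (enter a) \<inter> row_cols k (leave b) g = row_cols k (leave b) (enter a)"
    by (auto simp: row_cols_def)
  let ?A = "set (low a) \<union> verts R" and ?B = "set (high b) \<union> verts S"
  have "k < fst e" if "e \<in> ?A" for e
    using that set_low_high(1)[of e a] low_rest_rows(1)[OF a(2), of e] by blast
  moreover have "fst e < k" if "e \<in> ?B" for e
    using that set_low_high(2)[of e b] high_rest_rows(1)[OF b(2), of e] by blast
  ultimately have "?A \<inter> ?B = {}" "?A \<inter> Pair k ` X = {}" "Pair k ` X \<inter> ?B = {}" for X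
    unfolding disjoint_iff by (metis less_asym, (metis imageE fst_conv less_irrefl)+)
  then have "(?A \<union> Pair k ` X) \<inter> (?B \<union> Pair k ` Y) = Pair k ` (X \<inter> Y)" for X Y
    by blast
  moreover have "verts (insert a R) = ?A \<union> Pair k ` row_cols k c (enter a)"
    "verts (insert b S) = ?B \<union> Pair k ` row_cols k (leave b) g"
    using set_parts(1)[OF a(1)] set_parts(2)[OF b(1)] by auto
  ultimately show ?thesis by (simp only: rows)
qed

lemma verts_Int_nonempty_iff:
  assumes a: "arriving a" "low_rest a R" and b: "departing b" "high_rest b S"
  shows "verts (insert a R) \<inter> verts (insert b S) \<noteq> {} \<longleftrightarrow> leave b \<le> enter a"
  unfolding verts_Int[OF a b] using arriving_shape(3)[OF a(1)] by (auto simp: row_cols_def)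

text \<open>Together the two families cover row \<open>k\<close>, with the segment from
  \<open>leave b\<close> to \<open>enter a\<close> counted twice. The exchanged family covers that
  segment once, so the factor left over is the full row.\<close>

lemma weight_exchange:
  assumes a: "arriving a" "low_rest a R" and b: "departing b" "high_rest b S" and le: "leave b \<le> enter a"
  shows "rho r \<pi> (k, c) * u r \<pi> (insert (merge a b) (R \<union> S))
    = u r \<pi> (insert a R) * (u r \<pi> (insert b S) :: 'a::comm_ring_1 mpoly)"
proof -
  let ?T = "set (low a) \<union> verts R \<union> set (high b) \<union> verts S"
  let ?seg = "Pair k ` row_cols k (leave b) (enter a)" and ?row = "Pair k ` row_cols k c g"
  have "(k, x) \<notin> ?T" for x
    using set_low_high(1)[of "(k, x)" a] set_low_high(2)[of "(k, x)" b]
      low_rest_rows(1)[OF a(2), of "(k, x)"] high_rest_rows(1)[OF b(2), of "(k, x)"] by auto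
  then have disj: "?T \<inter> ?seg = {}" "?T \<inter> ?row = {}" by blast+
  have bounds: "c \<le> leave b" "enter a \<le> g"
    using row_nz(3) arriving_shape(3)[OF a(1)] departing_shape(3)[OF b(1)] by auto
  then have "row_cols k c (enter a) \<union> row_cols k (leave b) g = row_cols k c g"
    using le by (auto simp: row_cols_def)
  then have Un: "verts (insert a R) \<union> verts (insert b S) = ?T \<union> ?row"
    using set_parts(1)[OF a(1)] set_parts(2)[OF b(1)] by auto
  have m: "verts (insert (merge a b) (R \<union> S)) = ?T \<union> ?seg"
    by (auto simp: merge_def set_row_seg)
  have "u r \<pi> (insert a R) * (u r \<pi> (insert b S) :: 'a mpoly) = weight r \<pi> (?T \<union> ?row) * weight r \<pi> ?seg"
    unfolding u_weight Un[symmetric] verts_Int[OF a b, symmetric] by (rule weight_Un_Int[symmetric])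
  also have "\<dots> = weight r \<pi> ?T * rho r \<pi> (k, c) * weight r \<pi> ?seg"
    unfolding weight_Un_disjoint[OF disj(2)] weight_row ..
  also have "\<dots> = rho r \<pi> (k, c) * weight r \<pi> (?T \<union> ?seg)"
    unfolding weight_Un_disjoint[OF disj(1)] by (simp add: ac_simps)
  finally show ?thesis by (simp only: u_weight m)
qed

text \<open>These pairs produce the correction term: \<open>exchange\<close> and
  \<open>unexchange\<close> are mutually inverse, and \<open>weight_exchange\<close> compares the
  summands.\<close>

lemma sum_meeting_pairs:
  "(\<Sum>(P1, P2) \<in> {(P1, P2). P1 \<in> low_fams \<and> P2 \<in> high_fams \<and> verts P1 \<inter> verts P2 \<noteq> {}}.
      u r \<pi> P1 * u r \<pi> P2 :: 'a::comm_ring_1 mpoly)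
   = (\<Sum>Q\<in>cross_fams. rho r \<pi> (k, c) * u r \<pi> Q)" (is "sum _ ?X = _")
proof (rule sum.reindex_bij_witness[of _ unexchange exchange])
  fix PP assume "PP \<in> ?X"
  then obtain P1 P2 where PP: "PP = (P1, P2)" "P1 \<in> low_fams" "P2 \<in> high_fams" "verts P1 \<inter> verts P2 \<noteq> {}"
    by blast
  obtain a R where a: "P1 = insert a R" "arriving a" "low_rest a R" using PP(2) low_fams_iff by blast
  obtain b S where b: "P2 = insert b S" "departing b" "high_rest b S" using PP(3) high_fams_iff by blast
  have le: "leave b \<le> enter a" using PP(4) verts_Int_nonempty_iff[OF a(2,3) b(2,3)] unfolding a(1) b(1) by simp
  have PP_eq: "PP = (insert a R, insert b S)" using PP(1) a(1) b(1) by simp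
  have ex: "exchange PP = insert (merge a b) (R \<union> S)"
    unfolding PP_eq by (rule exchange_insert[OF a(2,3) b(2,3)])
  note m = merge_crossing[OF a(2) b(2) le]
  note rests = merge_rests[OF a(2,3) b(2,3) le]
  show "unexchange (exchange PP) = PP"
    unfolding ex unexchange_insert[OF m(1) rests] m(4,5) by (rule PP_eq[symmetric])
  show "exchange PP \<in> cross_fams"
    unfolding ex cross_fams_iff using m(1) rests by blast
  show "rho r \<pi> (k, c) * u r \<pi> (exchange PP) = ((case PP of (P1, P2) \<Rightarrow> u r \<pi> P1 * u r \<pi> P2) :: 'a mpoly)"
    unfolding ex weight_exchange[OF a(2,3) b(2,3) le] by (simp add: PP_eq)
next
  fix Q assume "Q \<in> cross_fams"
  then obtain q R S where Q: "Q = insert q (R \<union> S)" and q: "crossing q" and R: "low_rest q R" and S: "high_rest q S"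
    unfolding cross_fams_iff by blast
  have un: "unexchange Q = (insert (cut_low q) R, insert (cut_high q) S)"
    unfolding Q by (rule unexchange_insert[OF q R S])
  note a = cut_low_arriving[OF q] and b = cut_high_departing[OF q] and rests = cut_rests[OF q R S]
  show "exchange (unexchange Q) = Q"
    unfolding un exchange_insert[OF a(1) rests(1) b(1) rests(2)] merge_cut[OF q] by (rule Q[symmetric])
  have "verts (insert (cut_low q) R) \<inter> verts (insert (cut_high q) S) \<noteq> {}"
    unfolding verts_Int_nonempty_iff[OF a(1) rests(1) b(1) rests(2)] a(4) b(4) by (rule crossing_shape(6)[OF q])
  moreover have "insert (cut_low q) R \<in> low_fams" "insert (cut_high q) S \<in> high_fams"
    unfolding low_fams_iff high_fams_iff using a(1) b(1) rests by blast+
  ultimately show "unexchange Q \<in> ?X" unfolding un by blast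
qed

text \<open>These pairs produce the left-hand side of the identity. Sorting the paths of a full
  family by whether they start below row \<open>k\<close> inverts the union, and weights of disjoint
  families multiply.\<close>

lemma sum_disjoint_pairs:
  "(\<Sum>(P1, P2) \<in> {(P1, P2). P1 \<in> low_fams \<and> P2 \<in> high_fams \<and> verts P1 \<inter> verts P2 = {}}.
      u r \<pi> P1 * u r \<pi> P2 :: 'a::comm_ring_1 mpoly)
   = (\<Sum>P\<in>full_fams. u r \<pi> P)" (is "sum _ ?X = _")
proof (rule sum.reindex_bij_witness[of _ "\<lambda>P. ({p \<in> P. k < fst (hd p)}, {p \<in> P. \<not> k < fst (hd p)})"
    "\<lambda>(P1, P2). P1 \<union> P2"])
  fix PP assume "PP \<in> ?X"
  then obtain P1 P2 where PP: "PP = (P1, P2)" "P1 \<in> low_fams" "P2 \<in> high_fams" "verts P1 \<inter> verts P2 = {}"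
    by blast
  have "k < fst (hd p)" if "p \<in> P1" for p using path_in_fam(3)[OF PP(2) that] Ol by simp
  moreover have "\<not> k < fst (hd p)" if "p \<in> P2" for p
    using path_in_fam(3)[OF PP(3) that] Ou[of "hd p"] by auto
  ultimately have "{p \<in> P1 \<union> P2. k < fst (hd p)} = P1" "{p \<in> P1 \<union> P2. \<not> k < fst (hd p)} = P2"
    by blast+
  then show "(\<lambda>P. ({p \<in> P. k < fst (hd p)}, {p \<in> P. \<not> k < fst (hd p)})) (case PP of (P1, P2) \<Rightarrow> P1 \<union> P2) = PP"
    unfolding PP(1) by simp
  show "(case PP of (P1, P2) \<Rightarrow> P1 \<union> P2) \<in> full_fams"
    unfolding PP(1) using disjoint_paths_L_Un[OF PP(2-4)] by simp
  show "u r \<pi> (case PP of (P1, P2) \<Rightarrow> P1 \<union> P2) = ((case PP of (P1, P2) \<Rightarrow> u r \<pi> P1 * u r \<pi> P2) :: 'a mpoly)"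
    unfolding PP(1) by (simp add: u_weight weight_Un_disjoint[OF PP(4)])
next
  fix P assume P: "P \<in> full_fams"
  show "(case ({p \<in> P. k < fst (hd p)}, {p \<in> P. \<not> k < fst (hd p)}) of (P1, P2) \<Rightarrow> P1 \<union> P2) = P"
    by auto
  have "verts {p \<in> P. k < fst (hd p)} \<inter> verts {p \<in> P. \<not> k < fst (hd p)} = {}"
    by (rule disjoint_paths_L_disjnt[OF P]) auto
  then show "({p \<in> P. k < fst (hd p)}, {p \<in> P. \<not> k < fst (hd p)}) \<in> ?X"
    using full_fam_split[OF P] by blast
qed

lemma PL_cut:
  "(PL r \<pi> (Ol \<union> insert (k, g) Ou) (insert (k, c) Dl \<union> Du) :: 'a::comm_ring_1 mpoly) =
     PL r \<pi> Ol (insert (k, c) Dl) * PL r \<pi> (insert (k, g) Ou) Du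
     - rho r \<pi> (k, c) * PL r \<pi> (Ol \<union> Ou) (Dl \<union> Du)"
proof -
  let ?w = "\<lambda>(P1, P2). u r \<pi> P1 * u r \<pi> P2 :: 'a mpoly"
  let ?X = "{(P1, P2). P1 \<in> low_fams \<and> P2 \<in> high_fams \<and> verts P1 \<inter> verts P2 \<noteq> {}}"
  let ?Y = "{(P1, P2). P1 \<in> low_fams \<and> P2 \<in> high_fams \<and> verts P1 \<inter> verts P2 = {}}"
  have split: "low_fams \<times> high_fams = ?X \<union> ?Y" by auto
  have fin: "finite (low_fams \<times> high_fams)" by (simp add: finite_disjoint_paths_L)
  then have finXY: "finite ?X" "finite ?Y" unfolding split by simp_all
  have "PL r \<pi> Ol (insert (k, c) Dl) * PL r \<pi> (insert (k, g) Ou) Du = sum ?w (low_fams \<times> high_fams)"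
    unfolding PL_def sum_product sum.cartesian_product ..
  also have "\<dots> = sum ?w ?X + sum ?w ?Y"
    unfolding split by (rule sum.union_disjoint[OF finXY]) blast
  also have "\<dots> = rho r \<pi> (k, c) * PL r \<pi> (Ol \<union> Ou) (Dl \<union> Du)
      + PL r \<pi> (Ol \<union> insert (k, g) Ou) (insert (k, c) Dl \<union> Du)"
    unfolding sum_meeting_pairs sum_disjoint_pairs PL_def sum_distrib_left ..
  finally show ?thesis by simp
qed

end

section \<open>The given sets cut at the row of the leftmost 1-entry\<close>

theorem lemma5p15:
  fixes r d m h :: nat and \<pi> l :: "nat \<Rightarrow> nat" and D Os :: "(nat \<times> nat) set"
  assumes "r \<ge> 2" and "\<pi> permutes {1..r}" and "d \<in> {1..r}"
    and "strict_mono_on {1..m} l" and "D = (\<lambda>k. one_entry \<pi> (l k)) ` {1..m}"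
    and "PL_decomposable r \<pi> d D"
    and "h \<in> {1..m}"
    and "\<forall>k\<in>{1..m}. fst (one_entry \<pi> (l h)) \<le> fst (one_entry \<pi> (l k))"
    and "Os = ({gam r \<pi> (one_entry \<pi> (\<pi> d))} \<union> gam r \<pi> ` D) - {gam r \<pi> (one_entry \<pi> (l h))}"
    and "h > 1"
  shows "(PL r \<pi> Os D :: 'a::comm_ring_1 mpoly) =
     PL r \<pi> (weakly_below (inv \<pi> (l 1) + 1) Os) (weakly_below (inv \<pi> (l 1)) D)
       * PL r \<pi> (weakly_above (inv \<pi> (l 1)) Os) (weakly_above (inv \<pi> (l 1) - 1) D)
     - rho r \<pi> (one_entry \<pi> (l 1))
       * PL r \<pi> (Os - {gam r \<pi> (one_entry \<pi> (l 1))}) (D - {one_entry \<pi> (l 1)})"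
proof -
  define k where "k = inv \<pi> (l 1)"
  \<comment> \<open>Since \<open>gam\<close> depends only on the row of its argument, origins can be
    indexed injectively by rows.\<close>
  define G where "G i = (i, Max {j. (i, j) \<in> nz r \<pi>})" for i
  define RD where "RD = fst ` D"
  define Rh where "Rh = inv \<pi> (l h)"
  interpret perm_entries r \<pi> by unfold_locales (rule assms(2))
  have one: "1 \<in> {1..m}" using assms(7) by simp
  have D_mem: "e \<in> D \<longleftrightarrow> (\<exists>j\<in>{1..m}. e = (inv \<pi> (l j), l j))" for e
    unfolding assms(5) one_entry_def by blast
  have D_one: "\<pi> (fst e) = snd e" "snd e \<in> {1..r}" "fst e < d" if "e \<in> D" for e
  proof -
    show e: "\<pi> (fst e) = snd e" using that by (auto simp: D_mem)
    have sub: "D \<subseteq> one_entries r \<pi>" using assms(6) by (simp add: PL_decomposable_def)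
    then show "snd e \<in> {1..r}" using that by (auto simp: one_entries_def one_entry_def)
    have "one_entry \<pi> (snd e) = e" using e by (metis inv_\<pi>(1) one_entry_def prod.collapse)
    then show "fst e < d" using that assms(6)
      unfolding PL_decomposable_def by (metis fst_conv one_entry_def)
  qed
  have D_unique: "e = f" if "e \<in> D" "f \<in> D" "fst e = fst f" for e f
    using D_one(1) that by (metis prod_eqI)
  have kc: "(k, l 1) \<in> D" using one by (auto simp: D_mem k_def)
  have Rh: "(Rh, l h) \<in> D" using assms(7) by (auto simp: D_mem Rh_def)
  \<comment> \<open>As \<open>h > 1\<close>, the highest element differs from the leftmost one, so
    it lies strictly above row \<open>k\<close>.\<close>
  have "l 1 < l h" using assms(4,7,10) one by (auto simp: strict_mono_on_def)
  have "Rh \<noteq> k" using D_unique[OF Rh kc] \<open>l 1 < l h\<close> by auto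
  moreover have "Rh \<le> k" using assms(8) one by (simp add: one_entry_def k_def Rh_def)
  ultimately have Rhk: "Rh < k" by simp
  \<comment> \<open>This supplies the column condition on \<open>Du\<close>, with
    \<open>c = l 1\<close>.\<close>
  have l1_le: "l 1 \<le> snd e" if "e \<in> D" for e
    using that one strict_mono_on_leD[OF assms(4)] by (auto simp: D_mem)
  have kr: "k \<in> {1..r}" using D_one(1,2)[OF kc] \<pi>_in(1)[of k] by simp
  have kd: "k < d" using D_one(3)[OF kc] by simp
  have gam: "gam r \<pi> e = G (fst e)" for e by (simp add: gam_def G_def)
  have G_inj: "G i = G j \<longleftrightarrow> i = j" for i j by (auto simp: G_def)
  have RhRD: "Rh \<in> RD" and kRD: "k \<in> RD" using imageI[OF Rh, of fst] imageI[OF kc, of fst] by (simp_all add: RD_def)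
  \<comment> \<open>Row \<open>d\<close> is below all of \<open>D\<close>, so the origin removed
    from \<open>Os\<close> is not the one in row \<open>d\<close>.\<close>
  have "d \<noteq> Rh" using D_one(3)[OF Rh] by simp
  then have Os: "Os = G ` (insert d (RD - {Rh}))"
    unfolding assms(9) gam one_entry_def RD_def Rh_def by (auto simp: G_inj)
  have Os_row: "e \<in> Os \<longleftrightarrow> e = G (fst e) \<and> fst e \<in> insert d (RD - {Rh})" for e
    unfolding Os by (auto simp: G_def)
  have Gk: "G k \<in> Os" using kRD Rhk by (simp add: Os)
  let ?g = "Max {j. (k, j) \<in> nz r \<pi>}"
  let ?Ol = "{e \<in> Os. k < fst e}" and ?Ou = "{e \<in> Os. fst e < k}"
  let ?Dl = "{e \<in> D. k < fst e}" and ?Du = "{e \<in> D. fst e < k}"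
  have finD: "finite D" unfolding assms(5) by simp
  then have finRD: "finite RD" by (simp add: RD_def)
  \<comment> \<open>Row \<open>d\<close> does not occur above row \<open>k\<close>, so the origins
    there come from \<open>D\<close>. Row \<open>Rh\<close> is missing among them but has an
    endpoint, which gives the excess of one in \<open>cards\<close>.\<close>
  have "?Ou = G ` {i \<in> RD - {Rh}. i < k}" using kd by (auto simp: Os G_def)
  then have "card ?Ou = card {i \<in> RD - {Rh}. i < k}"
    by (simp add: card_image inj_on_def G_def)
  moreover have "insert Rh {i \<in> RD - {Rh}. i < k} = {i \<in> RD. i < k}"
    using RhRD Rhk by auto
  then have "card {i \<in> RD. i < k} = Suc (card {i \<in> RD - {Rh}. i < k})"
    using finRD card_insert_disjoint[of "{i \<in> RD - {Rh}. i < k}" Rh] by simp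
  moreover have "{i \<in> RD. i < k} = fst ` ?Du" by (auto simp: RD_def)
  moreover have "inj_on fst ?Du" using D_unique by (auto simp: inj_on_def)
  ultimately have cards: "card ?Du = Suc (card ?Ou)" by (simp add: card_image)
  have finOs: "finite Os" using finRD by (simp add: Os)
  interpret cut_families r \<pi> k "l 1" ?g ?Ol ?Ou ?Dl ?Du
    using kr D_one(1)[OF kc] finD finOs cards l1_le by unfold_locales auto
  have Gk_eq: "G k = (k, ?g)" by (simp add: G_def)
  have k_Os: "e \<in> Os \<and> fst e = k \<longleftrightarrow> e = (k, ?g)" for e
    using Gk Os_row[of e] unfolding Gk_eq[symmetric] by (auto simp: G_def)
  have k_D: "e \<in> D \<and> fst e = k \<longleftrightarrow> e = (k, l 1)" for e
    using kc D_unique[of e "(k, l 1)"] by auto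
  \<comment> \<open>The cutoff \<open>k + 1\<close> for origins against \<open>k\<close> for
    endpoints puts \<open>(k, ?g)\<close> in the upper factor and \<open>(k, l 1)\<close> in the
    lower one.\<close>
  have O_parts: "?Ol \<union> insert (k, ?g) ?Ou = Os" "weakly_below (k + 1) Os = ?Ol"
    "weakly_above k Os = insert (k, ?g) ?Ou" "Os - {(k, ?g)} = ?Ol \<union> ?Ou"
    unfolding weakly_below_def weakly_above_def using k_Os by (auto simp: set_eq_iff) (force simp: not_less le_less)+
  \<comment> \<open>As \<open>k\<close> is at least 1 by \<open>kr\<close>, truncated subtraction in
    \<open>k - 1\<close> does no harm.\<close>
  have D_parts: "insert (k, l 1) ?Dl \<union> ?Du = D" "weakly_below k D = insert (k, l 1) ?Dl"
    "weakly_above (k - 1) D = ?Du" "D - {(k, l 1)} = ?Dl \<union> ?Du"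
    unfolding weakly_below_def weakly_above_def using k_D kr by (auto simp: set_eq_iff) (force simp: not_less le_less)+
  have "one_entry \<pi> (l 1) = (k, l 1)" "gam r \<pi> (k, l 1) = (k, ?g)"
    by (simp_all add: one_entry_def k_def gam_def)
  then show ?thesis
    using PL_cut[where 'a='a] O_parts D_parts unfolding k_def[symmetric] by simp
qed

end
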